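(* Consider the linear IV model and the CLC test described in the context. Suppose Assumption 2 holds and $$\big(Q_{e(\beta_0),e(\beta_0)}-\Delta^2\mathcal{C},\;Q_{X,e(\beta_0)}-\Delta\mathcal{C},\;Q_{X,X}-\mathcal{C}\big)^\top=O_p(1).$$ Further suppose that we are under strong identification with fixed alternatives: $\mathcal{C}=\widetilde{\mathcal{C}}/d_n$ for a bounded constant $\widetilde{\mathcal{C}}$ independent of $n$ and a deterministic sequence $d_n\to0$, with $|\mathcal{C}|\to\infty$, and $\Delta=\beta-\beta_0$ is nonzero and fixed. Then, for $s\in\{pp,krs\}$, $$\widehat\phi_{\mathcal{A}_s(\widehat D,\widehat\gamma(\beta_0))}\xrightarrow{p}1 .$$
   Context: **Model (drifting sequence in $n$; dependence on $n$ suppressed).** $Y_i=X_i\beta+e_i$, $X_i=\Pi_i+V_i$, $i\in[n]=\{1,\dots,n\}$, all scalar, $\Pi_i=\mathbb{E}X_i$, $\mathbb{E}V_i=\mathbb{E}e_i=0$, $(e_i,V_i)$ possibly heteroskedastic. Instruments $Z_i\in\mathbb{R}^K$ are non-random, $K\to\infty$ with $n$ (possibly at the same order as $n$); $Z$ is the $n\times K$ matrix with rows $Z_i^\top$ and $P=Z(Z^\top Z)^{-1}Z^\top$. $Q_{a,b}=K^{-1/2}\sum_{i\in[n]}\sum_{j\ne i}a_iP_{ij}b_j$; $\mathcal{C}=Q_{\Pi,\Pi}$. $\beta_0$ is the hypothesized value, $\Delta=\beta-\beta_0$, $e_i(\beta_0)=Y_i-X_i\beta_0=e_i+X_i\Delta$.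 **Variance functions.** For constants $(\Phi_1,\Phi_{12},\Phi_{13},\Psi,\tau,\Upsilon)$ (the asymptotic variances and covariances of $(Q_{e,e},Q_{X,e},Q_{X,X}-\mathcal{C})$, in the arrangement $\begin{pmatrix}\Phi_1&\Phi_{12}&\Phi_{13}\\ \Phi_{12}&\Psi&\tau\\ \Phi_{13}&\tau&\Upsilon\end{pmatrix}$): $\Phi_1(\beta_0)=\Delta^4\Upsilon+4\Delta^3\tau+\Delta^2(4\Psi+2\Phi_{13})+4\Delta\Phi_{12}+\Phi_1$; $\Phi_{12}(\beta_0)=\Delta^3\Upsilon+3\Delta^2\tau+\Delta(2\Psi+\Phi_{13})+\Phi_{12}$; $\Phi_{13}(\beta_0)=\Delta^2\Upsilon+2\Delta\tau+\Phi_{13}$; $\Psi(\beta_0)=\Delta^2\Upsilon+2\Delta\tau+\Psi$; $\tau(\beta_0)=\Delta\Upsilon+\tau$; $\rho(\beta_0)=\Phi_{12}(\beta_0)/\sqrt{\Phi_1(\beta_0)\Psi(\beta_0)}\in(-1,1)$; $\gamma(\beta_0)=(\Phi_1(\beta_0),\Phi_{12}(\beta_0),\Phi_{13}(\beta_0),\Psi(\beta_0),\tau(\beta_0),\Upsilon,\rho(\beta_0))$. **Assumption 2.** $\mathcal{B}\subset\mathbb{R}$ is a compact parameter space, $\inf_{\beta_0\in\mathcal{B}}\Phi_1(\beta_0)>0$, $\inf_{\beta_0\in\mathcal{B}}\Psi(\beta_0)>0$, $\Upsilon>0$, and there is an estimator $\widehat\gamma(\beta_0)=(\widehat\Phi_1(\beta_0),\widehat\Phi_{12}(\beta_0),\widehat\Phi_{13}(\beta_0),\widehat\Psi(\beta_0),\widehat\tau(\beta_0),\widehat\Upsilon,\widehat\rho(\beta_0))$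 with $\|\widehat\gamma(\beta_0)-\gamma(\beta_0)\|_2=o_p(1)$ for $\beta_0\in\mathcal{B}$. (The true $\beta$ also lies in the parameter space $\mathcal{B}$.) **Statistics.** $AR(\beta_0)=Q_{e(\beta_0),e(\beta_0)}/\widehat\Phi_1^{1/2}(\beta_0)$, $LM(\beta_0)=Q_{X,e(\beta_0)}/\widehat\Psi^{1/2}(\beta_0)$, $LM^*(\beta_0)=(1-\widehat\rho(\beta_0)^2)^{-1/2}(LM(\beta_0)-\widehat\rho(\beta_0)AR(\beta_0))$, $$\widehat D=Q_{X,X}-(Q_{e(\beta_0),e(\beta_0)},Q_{X,e(\beta_0)})\begin{pmatrix}\widehat\Phi_1(\beta_0)&\widehat\Phi_{12}(\beta_0)\\ \widehat\Phi_{12}(\beta_0)&\widehat\Psi(\beta_0)\end{pmatrix}^{-1}\begin{pmatrix}\widehat\Phi_{13}(\beta_0)\\ \widehat\tau(\beta_0)\end{pmatrix}.$$ **Critical values.** $\alpha\in(0,1)$ is the level. $\mathcal{Z}(\mu)$ denotes an $\mathcal{N}(\mu,1)$ variable; $\mathcal{Z}_1(\cdot),\mathcal{Z}_2(\cdot)$ are independent such variables. $\mathbb{C}_\alpha(a_1,a_2;\rho)$ is the $(1-\alpha)$ quantile of $a_1\mathcal{Z}_1^2+a_2(\rho\mathcal{Z}_1+(1-\rho^2)^{1/2}\mathcal{Z}_2)^2+(1-a_1-a_2)\mathcal{Z}_2^2$ with $\mathcal{Z}_1,\mathcal{Z}_2$ independent standard normal. $\mathbb{A}_0=\{(a_1,a_2)\in[0,1]^2:a_1+a_2\le\overline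 a\}$ for a fixed $\overline a<1$; $\mathbb{C}_{\alpha,\max}(\rho)=\sup_{(a_1,a_2)\in\mathbb{A}_0}\mathbb{C}_\alpha(a_1,a_2;\rho)$. **CLC weights and test.** $\mathcal{D}(\beta_0)=\{\delta:\delta+\beta_0\in\mathcal{B}\}$, $(p_1,p_2)=(0.01,1.1)$. For a vector $r=(\Phi_1,\Phi_{12},\Phi_{13},\Psi,\tau,\Upsilon,\rho)$ in the parameter space $\Gamma$ of $\gamma(\beta_0)$ put - $G(\delta;r)=1-(\delta^2,\delta)\begin{pmatrix}\Phi_1&\Phi_{12}\\ \Phi_{12}&\Psi\end{pmatrix}^{-1}\begin{pmatrix}\Phi_{13}\\ \tau\end{pmatrix}$, $c_{\mathcal{B}}(r)=\sup_{\delta\in\mathcal{D}(\beta_0)}G(\delta;r)^2$; - $C_1(\delta;r)=\Phi_1^{-1/2}\delta^2/G(\delta;r)$, $C_2(\delta;r)=(1-\rho^2)^{-1/2}(\Psi^{-1/2}\delta-\rho\Phi_1^{-1/2}\delta^2)/G(\delta;r)$; - $\sigma_D(r)=\left(\Upsilon-(\Phi_{13},\tau)\begin{pmatrix}\Phi_1&\Phi_{12}\\ \Phi_{12}&\Psi\end{pmatrix}^{-1}\begin{pmatrix}\Phi_{13}\\ \tau\end{pmatrix}\right)^{1/2}$; - $\Delta_*(r)=\Phi_1^{1/2}\Psi^{-1/2}\rho^{-1}$ (so $1/\Delta_*^4(r)=\Psi^2\rho^4/\Phi_1^2$), $\underline a(\mu,r)=\min\left(p_1,\frac{p_2\,\mathbb{C}_{\alpha,\max}(\rho)\,\Phi_1\,c_{\mathcal{B}}(r)}{\Delta_*^4(r)\mu^2}\right)$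 with $C/0=+\infty$ for $C>0$; - $\mathbb{A}(\mu,r)=\{(a_1,a_2)\in\mathbb{A}_0:a_1\ge\underline a(\mu,r)\}$; - $\phi_{a_1,a_2,\infty}(\delta,\mu,r)=1\{a_1\mathcal{Z}_1^2(C_1(\delta;r)\mu)+a_2(\rho\mathcal{Z}_1(C_1(\delta;r)\mu)+(1-\rho^2)^{1/2}\mathcal{Z}_2(C_2(\delta;r)\mu))^2+(1-a_1-a_2)\mathcal{Z}_2^2(C_2(\delta;r)\mu)\ge\mathbb{C}_\alpha(a_1,a_2;\rho)\}$; - $(a_1(\mu,r),a_2(\mu,r))$ is a selection from $\arg\min_{(a_1,a_2)\in\mathbb{A}(\mu,r)}\sup_{\delta\in\mathcal{D}(\beta_0)}\big(\sup_{(a_1',a_2')\in\mathbb{A}(\mu,r)}\mathbb{E}\phi_{a_1',a_2',\infty}(\delta,\mu,r)-\mathbb{E}\phi_{a_1,a_2,\infty}(\delta,\mu,r)\big)$; - with $q=d^2/\sigma_D^2(r)$: $f_{pp}(d,r)=\sigma_D(r)\sqrt{\max(q-1,0)}$ and $f_{krs}(d,r)=\sigma_D(r)\sqrt{q-1+e^{-q/2}\big(\sum_{j\ge0}(-q/2)^j\frac{1}{j!(1+2j)}\big)^{-1}}$; - $\mathcal{A}_s(d,r)=(\mathcal{A}_{1,s}(d,r),\mathcal{A}_{2,s}(d,r))=(a_1(f_s(d,r),r),a_2(f_s(d,r),r))$, $s\in\{pp,krs\}$. The feasible jackknife CLC test is, writing $\mathcal{A}_{l,s}=\mathcal{A}_{l,s}(\widehat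 D,\widehat\gamma(\beta_0))$, $$\widehat\phi_{\mathcal{A}_s(\widehat D,\widehat\gamma(\beta_0))}=1\{\mathcal{A}_{1,s}AR^2(\beta_0)+\mathcal{A}_{2,s}LM^2(\beta_0)+(1-\mathcal{A}_{1,s}-\mathcal{A}_{2,s})LM^{*2}(\beta_0)\ge\mathbb{C}_\alpha(\mathcal{A}_{1,s},\mathcal{A}_{2,s};\widehat\rho(\beta_0))\}.$$ *)

theory Defs
  imports "HOL-Probability.Probability" "Jordan_Normal_Form.Gauss_Jordan_Elimination"
begin

section \<open>Stochastic order symbols along a sequence of probability spaces\<close>

text \<open>
  The outer measure agrees with the measure on measurable events, so this is ordinary convergence in
  probability whenever the \<open>X n\<close> are measurable. For a statistic not known to be measurable (here:
  one involving an arbitrary selection of minimisers) it is the convergence in outer probability;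
  with \<^const>\<open>measure\<close> in its place the claim could hold merely because non-measurable sets are
  assigned the value 0.
\<close>

definition conv_in_prob ::
  "(nat \<Rightarrow> 'a measure) \<Rightarrow> (nat \<Rightarrow> 'a \<Rightarrow> 'b::metric_space) \<Rightarrow> 'b \<Rightarrow> bool" where
  "conv_in_prob M X c \<longleftrightarrow>
     (\<forall>\<epsilon>>0. (\<lambda>n. outer_measure_of (M n) {\<omega> \<in> space (M n). \<epsilon> < dist (X n \<omega>) c}) \<longlonglongrightarrow> 0)"

definition bounded_in_prob ::
  "(nat \<Rightarrow> 'a measure) \<Rightarrow> (nat \<Rightarrow> 'a \<Rightarrow> 'b::real_normed_vector) \<Rightarrow> bool" where
  "bounded_in_prob M X \<longleftrightarrow>
     (\<forall>\<epsilon>>0. \<exists>L. \<forall>\<^sub>F n in sequentially.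
        outer_measure_of (M n) {\<omega> \<in> space (M n). L < norm (X n \<omega>)} < ennreal \<epsilon>)"

section \<open>The linear IV model\<close>

text \<open>Observations are indexed by \<open>{..<n}\<close> instead of \<open>{1..n}\<close>.\<close>

definition proj_mat :: "real mat \<Rightarrow> real mat" where
  "proj_mat Z = Z * the (mat_inverse (transpose_mat Z * Z)) * transpose_mat Z"

definition jack :: "real mat \<Rightarrow> (nat \<Rightarrow> real) \<Rightarrow> (nat \<Rightarrow> real) \<Rightarrow> real" where
  "jack Z a b =
     (\<Sum>i<dim_row Z. \<Sum>j\<in>{..<dim_row Z} - {i}. a i * proj_mat Z $$ (i, j) * b j) / sqrt (real (dim_col Z))"

text \<open>
  \<open>n\<close> is the sample size, \<open>M n\<close> the probability space of the \<open>n\<close>-th model, \<open>\<Pi>X n i\<close> the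
  deterministic first-stage mean.
\<close>

definition iv_model ::
  "(nat \<Rightarrow> 'a measure) \<Rightarrow> (nat \<Rightarrow> nat) \<Rightarrow> (nat \<Rightarrow> real mat) \<Rightarrow> (nat \<Rightarrow> nat \<Rightarrow> real) \<Rightarrow>
   (nat \<Rightarrow> nat \<Rightarrow> 'a \<Rightarrow> real) \<Rightarrow> (nat \<Rightarrow> nat \<Rightarrow> 'a \<Rightarrow> real) \<Rightarrow>
   (nat \<Rightarrow> nat \<Rightarrow> 'a \<Rightarrow> real) \<Rightarrow> (nat \<Rightarrow> nat \<Rightarrow> 'a \<Rightarrow> real) \<Rightarrow> real \<Rightarrow> bool" where
  "iv_model M K Z \<Pi>X V e X Y \<beta> \<longleftrightarrow>
     (\<forall>n. prob_space (M n)) \<and>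
     filterlim K at_top sequentially \<and>
     (\<forall>n\<ge>1. 1 \<le> K n \<and> Z n \<in> carrier_mat n (K n) \<and> invertible_mat (transpose_mat (Z n) * Z n)) \<and>
     (\<forall>n. \<forall>i<n. integrable (M n) (V n i) \<and> integral\<^sup>L (M n) (V n i) = 0 \<and>
                integrable (M n) (e n i) \<and> integral\<^sup>L (M n) (e n i) = 0) \<and>
     (\<forall>n. \<forall>i<n. \<forall>\<omega>\<in>space (M n). X n i \<omega> = \<Pi>X n i + V n i \<omega>) \<and>
     (\<forall>n. \<forall>i<n. \<forall>\<omega>\<in>space (M n). Y n i \<omega> = X n i \<omega> * \<beta> + e n i \<omega>)"

definition conc :: "(nat \<Rightarrow> real mat) \<Rightarrow> (nat \<Rightarrow> nat \<Rightarrow> real) \<Rightarrow> nat \<Rightarrow> real" where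
  "conc Z \<Pi>X n = jack (Z n) (\<Pi>X n) (\<Pi>X n)"

definition resid ::
  "(nat \<Rightarrow> nat \<Rightarrow> 'a \<Rightarrow> real) \<Rightarrow> (nat \<Rightarrow> nat \<Rightarrow> 'a \<Rightarrow> real) \<Rightarrow> real \<Rightarrow> nat \<Rightarrow> 'a \<Rightarrow> nat \<Rightarrow> real" where
  "resid X Y \<beta>0 n \<omega> i = Y n i \<omega> - X n i \<omega> * \<beta>0"

definition Q_ee ::
  "(nat \<Rightarrow> real mat) \<Rightarrow> (nat \<Rightarrow> nat \<Rightarrow> 'a \<Rightarrow> real) \<Rightarrow> (nat \<Rightarrow> nat \<Rightarrow> 'a \<Rightarrow> real) \<Rightarrow> real \<Rightarrow> nat \<Rightarrow> 'a \<Rightarrow> real" where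
  "Q_ee Z X Y \<beta>0 n \<omega> = jack (Z n) (resid X Y \<beta>0 n \<omega>) (resid X Y \<beta>0 n \<omega>)"

definition Q_Xe ::
  "(nat \<Rightarrow> real mat) \<Rightarrow> (nat \<Rightarrow> nat \<Rightarrow> 'a \<Rightarrow> real) \<Rightarrow> (nat \<Rightarrow> nat \<Rightarrow> 'a \<Rightarrow> real) \<Rightarrow> real \<Rightarrow> nat \<Rightarrow> 'a \<Rightarrow> real" where
  "Q_Xe Z X Y \<beta>0 n \<omega> = jack (Z n) (\<lambda>i. X n i \<omega>) (resid X Y \<beta>0 n \<omega>)"

definition Q_XX :: "(nat \<Rightarrow> real mat) \<Rightarrow> (nat \<Rightarrow> nat \<Rightarrow> 'a \<Rightarrow> real) \<Rightarrow> nat \<Rightarrow> 'a \<Rightarrow> real" where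
  "Q_XX Z X n \<omega> = jack (Z n) (\<lambda>i. X n i \<omega>) (\<lambda>i. X n i \<omega>)"

section \<open>Variance parameters\<close>

text \<open>
  \<open>avar\<close> is \<open>(\<Phi>\<^sub>1, \<Phi>\<^sub>1\<^sub>2, \<Phi>\<^sub>1\<^sub>3, \<Psi>, \<tau>, \<Upsilon>)\<close> and \<open>gpar\<close> is \<open>(\<Phi>\<^sub>1, \<Phi>\<^sub>1\<^sub>2, \<Phi>\<^sub>1\<^sub>3, \<Psi>, \<tau>, \<Upsilon>, \<rho>)\<close>. The library
  norm on nested products of reals is the Euclidean norm of the tuple.
\<close>

type_synonym avar = "real \<times> real \<times> real \<times> real \<times> real \<times> real"
type_synonym gpar = "real \<times> real \<times> real \<times> real \<times> real \<times> real \<times> real"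

fun g\<Phi>1 :: "gpar \<Rightarrow> real" where "g\<Phi>1 (\<Phi>1, \<Phi>12, \<Phi>13, \<Psi>, \<tau>, \<Upsilon>, \<rho>) = \<Phi>1"
fun g\<Phi>12 :: "gpar \<Rightarrow> real" where "g\<Phi>12 (\<Phi>1, \<Phi>12, \<Phi>13, \<Psi>, \<tau>, \<Upsilon>, \<rho>) = \<Phi>12"
fun g\<Phi>13 :: "gpar \<Rightarrow> real" where "g\<Phi>13 (\<Phi>1, \<Phi>12, \<Phi>13, \<Psi>, \<tau>, \<Upsilon>, \<rho>) = \<Phi>13"
fun g\<Psi> :: "gpar \<Rightarrow> real" where "g\<Psi> (\<Phi>1, \<Phi>12, \<Phi>13, \<Psi>, \<tau>, \<Upsilon>, \<rho>) = \<Psi>"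
fun g\<tau> :: "gpar \<Rightarrow> real" where "g\<tau> (\<Phi>1, \<Phi>12, \<Phi>13, \<Psi>, \<tau>, \<Upsilon>, \<rho>) = \<tau>"
fun g\<Upsilon> :: "gpar \<Rightarrow> real" where "g\<Upsilon> (\<Phi>1, \<Phi>12, \<Phi>13, \<Psi>, \<tau>, \<Upsilon>, \<rho>) = \<Upsilon>"
fun g\<rho> :: "gpar \<Rightarrow> real" where "g\<rho> (\<Phi>1, \<Phi>12, \<Phi>13, \<Psi>, \<tau>, \<Upsilon>, \<rho>) = \<rho>"

text \<open>
  Positive semidefiniteness of the symmetric matrix with rows \<open>(\<Phi>\<^sub>1, \<Phi>\<^sub>1\<^sub>2, \<Phi>\<^sub>1\<^sub>3)\<close>, \<open>(\<Phi>\<^sub>1\<^sub>2, \<Psi>, \<tau>)\<close>,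
  \<open>(\<Phi>\<^sub>1\<^sub>3, \<tau>, \<Upsilon>)\<close>, i.e. these constants are the entries of a covariance matrix.
\<close>

fun is_covariance :: "avar \<Rightarrow> bool" where
  "is_covariance (\<Phi>1, \<Phi>12, \<Phi>13, \<Psi>, \<tau>, \<Upsilon>) \<longleftrightarrow>
     (\<forall>x y z. 0 \<le> \<Phi>1 * x\<^sup>2 + \<Psi> * y\<^sup>2 + \<Upsilon> * z\<^sup>2 + 2 * \<Phi>12 * x * y + 2 * \<Phi>13 * x * z + 2 * \<tau> * y * z)"

fun gamma_at :: "avar \<Rightarrow> real \<Rightarrow> gpar" where
  "gamma_at (\<Phi>1, \<Phi>12, \<Phi>13, \<Psi>, \<tau>, \<Upsilon>) \<Delta> =
     (let \<Phi>1' = \<Delta>^4 * \<Upsilon> + 4 * \<Delta>^3 * \<tau> + \<Delta>\<^sup>2 * (4 * \<Psi> + 2 * \<Phi>13) + 4 * \<Delta> * \<Phi>12 + \<Phi>1;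
          \<Phi>12' = \<Delta>^3 * \<Upsilon> + 3 * \<Delta>\<^sup>2 * \<tau> + \<Delta> * (2 * \<Psi> + \<Phi>13) + \<Phi>12;
          \<Phi>13' = \<Delta>\<^sup>2 * \<Upsilon> + 2 * \<Delta> * \<tau> + \<Phi>13;
          \<Psi>' = \<Delta>\<^sup>2 * \<Upsilon> + 2 * \<Delta> * \<tau> + \<Psi>;
          \<tau>' = \<Delta> * \<Upsilon> + \<tau>
      in (\<Phi>1', \<Phi>12', \<Phi>13', \<Psi>', \<tau>', \<Upsilon>, \<Phi>12' / sqrt (\<Phi>1' * \<Psi>')))"

definition gamma0 :: "avar \<Rightarrow> real \<Rightarrow> real \<Rightarrow> gpar" where
  "gamma0 S \<beta> \<beta>0 = gamma_at S (\<beta> - \<beta>0)"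

text \<open>The last argument \<open>\<gamma>h n \<beta>0 \<omega>\<close> is the estimator of \<open>gamma0 S \<beta> \<beta>0\<close>.\<close>

definition assumption2 ::
  "(nat \<Rightarrow> 'a measure) \<Rightarrow> real set \<Rightarrow> avar \<Rightarrow> real \<Rightarrow> (nat \<Rightarrow> real \<Rightarrow> 'a \<Rightarrow> gpar) \<Rightarrow> bool" where
  "assumption2 M \<B> S \<beta> \<gamma>h \<longleftrightarrow>
     compact \<B> \<and>
     0 < (INF \<beta>0\<in>\<B>. g\<Phi>1 (gamma0 S \<beta> \<beta>0)) \<and>
     0 < (INF \<beta>0\<in>\<B>. g\<Psi> (gamma0 S \<beta> \<beta>0)) \<and>
     (\<forall>\<beta>0\<in>\<B>. 0 < g\<Upsilon> (gamma0 S \<beta> \<beta>0)) \<and>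
     (\<forall>\<beta>0\<in>\<B>. (\<forall>n. \<gamma>h n \<beta>0 \<in> borel_measurable (M n)) \<and>
               conv_in_prob M (\<lambda>n \<omega>. norm (\<gamma>h n \<beta>0 \<omega> - gamma0 S \<beta> \<beta>0)) 0)"

text \<open>
  The vectors for which the weights below are defined. The identity \<open>\<rho> = \<Phi>\<^sub>1\<^sub>2 / sqrt (\<Phi>\<^sub>1 \<Psi>)\<close> is not
  imposed: a consistent estimator of \<open>gamma0 S \<beta> \<beta>0\<close> then belongs to this open set with probability
  tending to one, whether or not its last component is computed from the others.
\<close>

definition par_space :: "gpar set" where
  "par_space = {r. 0 < g\<Phi>1 r \<and> 0 < g\<Psi> r \<and> 0 < g\<Upsilon> r \<and> 0 < g\<Phi>1 r * g\<Psi> r - (g\<Phi>12 r)\<^sup>2 \<and>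
                   -1 < g\<rho> r \<and> g\<rho> r < 1}"

text \<open>\<open>(x, y) S\<^sup>-\<^sup>1 (\<Phi>\<^sub>1\<^sub>3, \<tau>)\<^sup>T\<close> for the \<open>2 \<times> 2\<close> matrix \<open>S\<close> with rows \<open>(\<Phi>\<^sub>1, \<Phi>\<^sub>1\<^sub>2)\<close>, \<open>(\<Phi>\<^sub>1\<^sub>2, \<Psi>)\<close>.\<close>

definition proj13 :: "gpar \<Rightarrow> real \<Rightarrow> real \<Rightarrow> real" where
  "proj13 r x y =
     inner (vector [x, y] :: real^2)
       (matrix_inv (vector [vector [g\<Phi>1 r, g\<Phi>12 r], vector [g\<Phi>12 r, g\<Psi> r]] :: real^2^2)
          *v vector [g\<Phi>13 r, g\<tau> r])"

section \<open>Test statistics\<close>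

definition AR_stat :: "gpar \<Rightarrow> real \<Rightarrow> real" where
  "AR_stat r qee = qee / sqrt (g\<Phi>1 r)"

definition LM_stat :: "gpar \<Rightarrow> real \<Rightarrow> real" where
  "LM_stat r qxe = qxe / sqrt (g\<Psi> r)"

definition LMstar_stat :: "gpar \<Rightarrow> real \<Rightarrow> real \<Rightarrow> real" where
  "LMstar_stat r qee qxe = (LM_stat r qxe - g\<rho> r * AR_stat r qee) / sqrt (1 - (g\<rho> r)\<^sup>2)"

definition D_stat :: "gpar \<Rightarrow> real \<Rightarrow> real \<Rightarrow> real \<Rightarrow> real" where
  "D_stat r qee qxe qxx = qxx - proj13 r qee qxe"

section \<open>Critical values\<close>

definition normal_pair :: "real \<Rightarrow> real \<Rightarrow> (real \<times> real) measure" where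
  "normal_pair \<mu>1 \<mu>2 = density lborel (\<lambda>x. ennreal (normal_density \<mu>1 1 x)) \<Otimes>\<^sub>M
                        density lborel (\<lambda>x. ennreal (normal_density \<mu>2 1 x))"

definition lin_comb :: "real \<times> real \<Rightarrow> real \<Rightarrow> real \<times> real \<Rightarrow> real" where
  "lin_comb a \<rho> z = fst a * (fst z)\<^sup>2 + snd a * (\<rho> * fst z + sqrt (1 - \<rho>\<^sup>2) * snd z)\<^sup>2
                    + (1 - fst a - snd a) * (snd z)\<^sup>2"

definition crit :: "real \<Rightarrow> real \<times> real \<Rightarrow> real \<Rightarrow> real" where
  "crit \<alpha> a \<rho> =
     Inf {x. 1 - \<alpha> \<le> measure (normal_pair 0 0) {z \<in> space (normal_pair 0 0). lin_comb a \<rho> z \<le> x}}"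

definition A0 :: "real \<Rightarrow> (real \<times> real) set" where
  "A0 abar = {a. 0 \<le> fst a \<and> fst a \<le> 1 \<and> 0 \<le> snd a \<and> snd a \<le> 1 \<and> fst a + snd a \<le> abar}"

definition crit_max :: "real \<Rightarrow> real \<Rightarrow> real \<Rightarrow> real" where
  "crit_max \<alpha> abar \<rho> = (SUP a\<in>A0 abar. crit \<alpha> a \<rho>)"

section \<open>The weights\<close>

definition Dset :: "real set \<Rightarrow> real \<Rightarrow> real set" where
  "Dset \<B> \<beta>0 = {\<delta>. \<delta> + \<beta>0 \<in> \<B>}"

definition G :: "real \<Rightarrow> gpar \<Rightarrow> real" where
  "G \<delta> r = 1 - proj13 r (\<delta>\<^sup>2) \<delta>"

definition c_B :: "real set \<Rightarrow> real \<Rightarrow> gpar \<Rightarrow> real" where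
  "c_B \<B> \<beta>0 r = (SUP \<delta>\<in>Dset \<B> \<beta>0. (G \<delta> r)\<^sup>2)"

text \<open>
  Where \<open>G \<delta> r = 0\<close>, division by zero makes \<open>C1\<close> and \<open>C2\<close> vanish. All tests in the regret below
  then have equal power at \<open>\<delta>\<close>, so such \<open>\<delta>\<close> do not influence the minimax choice.
\<close>

definition C1 :: "real \<Rightarrow> gpar \<Rightarrow> real" where
  "C1 \<delta> r = \<delta>\<^sup>2 / sqrt (g\<Phi>1 r) / G \<delta> r"

definition C2 :: "real \<Rightarrow> gpar \<Rightarrow> real" where
  "C2 \<delta> r = (\<delta> / sqrt (g\<Psi> r) - g\<rho> r * \<delta>\<^sup>2 / sqrt (g\<Phi>1 r)) / sqrt (1 - (g\<rho> r)\<^sup>2) / G \<delta> r"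

text \<open>
  The lower bound for the first weight, with \<open>p\<^sub>1 = 0.01\<close>, \<open>p\<^sub>2 = 1.1\<close> and
  \<open>1 / \<Delta>\<^sub>*^4 = \<Psi>\<^sup>2 \<rho>^4 / \<Phi>\<^sub>1\<^sup>2\<close>. The first branch is \<open>C / 0 = \<infinity>\<close> for \<open>C > 0\<close>.
\<close>

definition a_lower :: "real \<Rightarrow> real \<Rightarrow> real set \<Rightarrow> real \<Rightarrow> real \<Rightarrow> gpar \<Rightarrow> real" where
  "a_lower \<alpha> abar \<B> \<beta>0 \<mu> r =
     (let inv_Dstar4 = (g\<Psi> r)\<^sup>2 * (g\<rho> r)^4 / (g\<Phi>1 r)\<^sup>2;
          C = 1.1 * crit_max \<alpha> abar (g\<rho> r) * g\<Phi>1 r * c_B \<B> \<beta>0 r * inv_Dstar4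
      in if \<mu> = 0 \<and> 0 < C then 0.01 else min 0.01 (C / \<mu>\<^sup>2))"

definition weight_set :: "real \<Rightarrow> real \<Rightarrow> real set \<Rightarrow> real \<Rightarrow> real \<Rightarrow> gpar \<Rightarrow> (real \<times> real) set" where
  "weight_set \<alpha> abar \<B> \<beta>0 \<mu> r = {a \<in> A0 abar. a_lower \<alpha> abar \<B> \<beta>0 \<mu> r \<le> fst a}"

text \<open>\<open>\<E> \<phi>\<^bsub>a,\<infinity>\<^esub>(\<delta>, \<mu>, r)\<close>\<close>

definition limit_power :: "real \<Rightarrow> real \<times> real \<Rightarrow> real \<Rightarrow> real \<Rightarrow> gpar \<Rightarrow> real" where
  "limit_power \<alpha> a \<delta> \<mu> r =
     (\<integral>z. of_bool (crit \<alpha> a (g\<rho> r) \<le> lin_comb a (g\<rho> r) z) \<partial>normal_pair (C1 \<delta> r * \<mu>) (C2 \<delta> r * \<mu>))"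

definition max_regret ::
  "real \<Rightarrow> real \<Rightarrow> real set \<Rightarrow> real \<Rightarrow> real \<Rightarrow> gpar \<Rightarrow> real \<times> real \<Rightarrow> real" where
  "max_regret \<alpha> abar \<B> \<beta>0 \<mu> r a =
     (SUP \<delta>\<in>Dset \<B> \<beta>0.
        (SUP a'\<in>weight_set \<alpha> abar \<B> \<beta>0 \<mu> r. limit_power \<alpha> a' \<delta> \<mu> r) - limit_power \<alpha> a \<delta> \<mu> r)"

text \<open>
  \<open>a\<close> is an arbitrary selection of minimisers, with no measurability requirement. The predicate
  presupposes that every \<^const>\<open>weight_set\<close> is nonempty, which holds for \<open>abar \<ge> 0.01\<close>.
\<close>

definition minimax_weights ::
  "real \<Rightarrow> real \<Rightarrow> real set \<Rightarrow> real \<Rightarrow> (real \<Rightarrow> gpar \<Rightarrow> real \<times> real) \<Rightarrow> bool" where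
  "minimax_weights \<alpha> abar \<B> \<beta>0 a \<longleftrightarrow>
     (\<forall>\<mu>. \<forall>r\<in>par_space.
        is_arg_min (max_regret \<alpha> abar \<B> \<beta>0 \<mu> r) (\<lambda>x. x \<in> weight_set \<alpha> abar \<B> \<beta>0 \<mu> r) (a \<mu> r))"

definition sigma_D :: "gpar \<Rightarrow> real" where
  "sigma_D r = sqrt (g\<Upsilon> r - proj13 r (g\<Phi>13 r) (g\<tau> r))"

text \<open>
  The shrinkage formulas are meaningful for \<open>\<sigma>\<^sub>D\<^sup>2 > 0\<close>; otherwise (for instance at an estimate
  outside the covariance cone) they take the values given by the total operations.
\<close>

definition f_pp :: "real \<Rightarrow> gpar \<Rightarrow> real" where
  "f_pp d r = (let q = d\<^sup>2 / (sigma_D r)\<^sup>2 in sigma_D r * sqrt (max (q - 1) 0))"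

definition f_krs :: "real \<Rightarrow> gpar \<Rightarrow> real" where
  "f_krs d r =
     (let q = d\<^sup>2 / (sigma_D r)\<^sup>2
      in sigma_D r * sqrt (q - 1 + exp (- q / 2) * inverse (\<Sum>j. (- q / 2) ^ j * (1 / (fact j * (1 + 2 * real j))))))"

datatype shrinkage = PP | KRS

fun shrink :: "shrinkage \<Rightarrow> real \<Rightarrow> gpar \<Rightarrow> real" where
  "shrink PP = f_pp"
| "shrink KRS = f_krs"

section \<open>The feasible test\<close>

definition CLC_test ::
  "real \<Rightarrow> (real \<Rightarrow> gpar \<Rightarrow> real \<times> real) \<Rightarrow> shrinkage \<Rightarrow> gpar \<Rightarrow> real \<Rightarrow> real \<Rightarrow> real \<Rightarrow> real" where
  "CLC_test \<alpha> a s r qee qxe qxx =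
     (let w = a (shrink s (D_stat r qee qxe qxx) r) r
      in of_bool (crit \<alpha> w (g\<rho> r) \<le>
           fst w * (AR_stat r qee)\<^sup>2 + snd w * (LM_stat r qxe)\<^sup>2
           + (1 - fst w - snd w) * (LMstar_stat r qee qxe)\<^sup>2))"

end

theory Submission
  imports Defs
begin

text \<open>
  On an event whose probability is as close to one as desired, the estimate \<open>r\<close> is near its limit
  \<open>r0\<close> and the three quadratic forms are within \<open>L\<close> of \<open>\<Delta>\<^sup>2 C\<close>, \<open>\<Delta> C\<close> and \<open>C\<close>, where \<open>\<bar>C\<bar>\<close> is large; the
  claim becomes a deterministic one there. The critical values are bounded by a constant. The
  statistic \<open>LM\<^sup>*\<close> is \<open>C\<close> times its value at \<open>(\<Delta>\<^sup>2, \<Delta>)\<close> up to a bounded error and carries weight at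
  least \<open>1 - abar\<close>, so the test rejects unless that value vanishes at \<open>r0\<close>. It vanishes only for
  \<open>\<Delta> = \<Delta>\<^sub>*\<close>, in which case \<open>AR\<close> takes over: neither shrinkage estimator exceeds \<open>\<bar>D\<bar>\<close>, and
  \<open>\<bar>D\<bar>\<close> is about \<open>\<bar>C\<bar> \<bar>G \<Delta> r\<bar> \<le> \<bar>C\<bar> sqrt c_B\<close>, so the lower bound on the first weight makes the \<open>AR\<close>
  term at least about \<open>1.1\<close> times the maximal critical value.
\<close>

section \<open>Bounds for the shrinkage estimators\<close>

text \<open>
  The series is \<open>\<integral> exp (- x * t\<^sup>2) dt\<close> over \<open>[0, 1]\<close>, evaluated here by the mean value theorem.
\<close>

lemma krs_series_bounds:
  fixes x :: real
  assumes "0 \<le> x"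
  defines "s \<equiv> (\<Sum>j. (- x) ^ j * (1 / (fact j * (1 + 2 * real j))))"
  shows "exp (- x) \<le> s" "s \<le> 1"
proof -
  define f where "f j t = (- x) ^ j * t ^ (2 * j + 1) / (fact j * (1 + 2 * real j))" for j t
  define f' where "f' j t = (- x * t\<^sup>2) ^ j /\<^sub>R fact j" for j t
  have der: "(f j has_field_derivative f' j t) (at t within {-2..2})" for j t
  proof -
    define c where "c = (- x) ^ j / (fact j * (1 + 2 * real j))"
    have "1 + 2 * real j \<noteq> 0" by linarith
    then have "c * (real (2 * j + 1) * t ^ (2 * j)) = f' j t"
      by (simp add: f'_def c_def divide_simps power_mult flip: power_mult_distrib)
    moreover have "((\<lambda>t. c * t ^ (2 * j + 1)) has_field_derivative c * (real (2 * j + 1) * t ^ (2 * j)))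
        (at t within {-2..2})"
      using DERIV_cmult[OF DERIV_pow[of "2 * j + 1" t "{-2..2}"], of c] by simp
    ultimately show ?thesis by (simp add: f_def[abs_def] c_def)
  qed
  have unif: "uniformly_convergent_on {-2..2} (\<lambda>n t. \<Sum>j<n. f' j t)"
  \<comment> \<open>On this interval \<open>x * t\<^sup>2 \<le> 4 * x\<close>, so the exponential
    series at \<open>4 * x\<close> is a majorant.\<close>
  proof (rule Weierstrass_m_test'[where M = "\<lambda>j. (4 * x) ^ j /\<^sub>R fact j"])
    fix j t assume "t \<in> {-2..2::real}"
    then have "\<bar>t\<bar> \<le> 2" by auto
    then have "t\<^sup>2 \<le> 2\<^sup>2" by (metis abs_le_square_iff abs_numeral)
    then have "x * t\<^sup>2 \<le> 4 * x" using mult_left_mono[of "t\<^sup>2" 4 x] assms(1) by simp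
    then have "(x * t\<^sup>2) ^ j \<le> (4 * x) ^ j"
      using assms(1) by (intro power_mono) auto
    then show "norm (f' j t) \<le> (4 * x) ^ j /\<^sub>R fact j"
      using assms by (auto simp: f'_def power_abs abs_mult intro!: mult_left_mono)
  qed (rule summable_exp_generic)
  have DERIV: "((\<lambda>t. \<Sum>j. f j t) has_field_derivative exp (- x * t\<^sup>2)) (at t)" if "t \<in> {0..1}" for t
  proof -
    \<comment> \<open>The interval \<open>{-2..2}\<close> has \<open>[0, 1]\<close> in its interior,
      so termwise differentiation gives two-sided derivatives at the endpoints 0 and 1 as
      well.\<close>
    have "((\<lambda>t. \<Sum>j. f j t) has_field_derivative (\<Sum>j. f' j t)) (at t)"
      using that
      by (intro has_field_derivative_series'(2)[of "{-2..2}", OF _ der unif, of 0])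
        (auto simp: f_def)
    then show ?thesis by (simp add: f'_def exp_def)
  qed
  obtain t where t: "0 < t" "t < 1"
    and eq: "(\<Sum>j. f j 1) - (\<Sum>j. f j 0) = (1 - 0) * exp (- x * t\<^sup>2)"
    using MVT2[of 0 1 "\<lambda>t. \<Sum>j. f j t" "\<lambda>t. exp (- x * t\<^sup>2)"] DERIV by auto
  have "s = exp (- x * t\<^sup>2)" using eq by (simp add: s_def f_def)
  moreover have "x * t\<^sup>2 \<le> x * 1"
    using t assms by (intro mult_left_mono) (auto simp: power_le_one)
  ultimately show "exp (- x) \<le> s" "s \<le> 1" using assms by auto
qed

text \<open>Both estimators have the form \<open>sigma_D r * sqrt u\<close> with
  \<open>0 \<le> u \<le> q\<close>, where \<open>q\<close> is the squared standardized value of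
  \<open>d\<close>.\<close>

lemma shrink_squared_le: "(shrink s d r)\<^sup>2 \<le> d\<^sup>2"
proof -
  define q where "q = d\<^sup>2 / (sigma_D r)\<^sup>2"
  \<comment> \<open>Division by zero gives \<open>q = 0\<close> when \<open>sigma_D r = 0\<close>,
    hence an inequality instead of an equation.\<close>
  have q: "0 \<le> q" "(sigma_D r)\<^sup>2 * q \<le> d\<^sup>2" by (auto simp: q_def)
  have bound: "(sigma_D r * sqrt u)\<^sup>2 \<le> d\<^sup>2" if "0 \<le> u" "u \<le> q" for u
  proof -
    have "(sigma_D r * sqrt u)\<^sup>2 = (sigma_D r)\<^sup>2 * u" using that by (simp add: power_mult_distrib)
    also have "\<dots> \<le> (sigma_D r)\<^sup>2 * q" using that by (intro mult_left_mono) auto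
    finally show ?thesis using q by simp
  qed
  show ?thesis
  proof (cases s)
    case PP
    then show ?thesis using q(1) bound[of "max (q - 1) 0"] by (simp add: f_pp_def Let_def flip: q_def)
  next
    case KRS
    define S where "S = (\<Sum>j. (- q / 2) ^ j * (1 / (fact j * (1 + 2 * real j))))"
    have S: "exp (- q / 2) \<le> S" "S \<le> 1"
      using krs_series_bounds[of "q / 2"] q(1) by (simp_all add: S_def)
    have "0 < S" using S(1) less_le_trans exp_gt_zero by blast
    \<comment> \<open>Since \<open>S \<le> 1\<close>, the exponential correction is at least
      \<open>1 - q / 2\<close>, which makes the radicand at least \<open>q / 2\<close>. The other
      series bound keeps it at most \<open>q\<close>.\<close>
    have "1 - q / 2 \<le> exp (- q / 2)" using exp_ge_add_one_self[of "- q / 2"] by simp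
    also have "\<dots> \<le> exp (- q / 2) * inverse S"
      using S \<open>0 < S\<close> by (simp add: field_simps)
    finally have "0 \<le> q - 1 + exp (- q / 2) * inverse S" using q(1) by linarith
    moreover have "exp (- q / 2) * inverse S \<le> 1" using S \<open>0 < S\<close> by (simp add: field_simps)
    ultimately show ?thesis
      using bound[of "q - 1 + exp (- q / 2) * inverse S"] KRS
      by (simp add: f_krs_def Let_def S_def flip: q_def)
  qed
qed

section \<open>Coordinates of the parameter vector and the explicit projection\<close>

lemma gpar_eq_projections:
  "g\<Phi>1 r = fst r" "g\<Phi>12 r = fst (snd r)" "g\<Phi>13 r = fst (snd (snd r))"
  "g\<Psi> r = fst (snd (snd (snd r)))" "g\<tau> r = fst (snd (snd (snd (snd r))))"
  "g\<Upsilon> r = fst (snd (snd (snd (snd (snd r)))))" "g\<rho> r = snd (snd (snd (snd (snd (snd r)))))"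
  by (cases r; simp)+

text \<open>Cramer's rule for a symmetric 2 by 2 system. It turns the matrix inverse into a rational
  function of the entries, on which all later estimates rest.\<close>

lemma proj13_eq:
  assumes "g\<Phi>1 r * g\<Psi> r - (g\<Phi>12 r)\<^sup>2 \<noteq> 0"
  shows "proj13 r x y =
    (x * (g\<Psi> r * g\<Phi>13 r - g\<Phi>12 r * g\<tau> r) + y * (g\<Phi>1 r * g\<tau> r - g\<Phi>12 r * g\<Phi>13 r))
      / (g\<Phi>1 r * g\<Psi> r - (g\<Phi>12 r)\<^sup>2)"
proof -
  define A :: "real^2^2" where "A = vector [vector [g\<Phi>1 r, g\<Phi>12 r], vector [g\<Phi>12 r, g\<Psi> r]]"
  define v :: "real^2" where "v = vector [g\<Phi>13 r, g\<tau> r]"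
  define w where "w = matrix_inv A *v v"
  let ?\<delta> = "g\<Phi>1 r * g\<Psi> r - (g\<Phi>12 r)\<^sup>2"
  have "det A = ?\<delta>" by (simp add: det_2 A_def power2_eq_square)
  then have "invertible A" using assms by (simp add: invertible_det_nz)
  \<comment> \<open>\<open>matrix_inv\<close> is a choice operator; invertibility ensures that the
    chosen matrix is a right inverse.\<close>
  then have "A ** matrix_inv A = Finite_Cartesian_Product.mat 1"
    unfolding invertible_def matrix_inv_def by (rule someI2_ex) simp
  then have "A *v w = v" by (simp add: w_def matrix_vector_mul_assoc)
  then have "(A *v w) $ 1 = v $ 1" "(A *v w) $ 2 = v $ 2" by simp_all
  then have w: "g\<Phi>1 r * w $ 1 + g\<Phi>12 r * w $ 2 = g\<Phi>13 r" "g\<Phi>12 r * w $ 1 + g\<Psi> r * w $ 2 = g\<tau> r"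
    by (simp_all add: matrix_vector_mult_def sum_2 A_def v_def)
  have "w $ 1 * ?\<delta> = g\<Psi> r * g\<Phi>13 r - g\<Phi>12 r * g\<tau> r"
    "w $ 2 * ?\<delta> = g\<Phi>1 r * g\<tau> r - g\<Phi>12 r * g\<Phi>13 r"
    unfolding w[symmetric] by (simp_all add: algebra_simps power2_eq_square)
  moreover have "proj13 r x y = x * w $ 1 + y * w $ 2"
    by (simp add: proj13_def w_def A_def v_def inner_vec_def sum_2)
  then have "proj13 r x y * ?\<delta> = x * (w $ 1 * ?\<delta>) + y * (w $ 2 * ?\<delta>)" by (simp add: algebra_simps)
  ultimately show ?thesis using assms by (simp add: eq_divide_eq)
qed

section \<open>Outer measures and a uniform bound on the critical values\<close>

text \<open>Measurable hulls attaining the two outer measures reduce this to subadditivity of the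
  measure.\<close>

lemma outer_measure_of_Un_le:
  assumes "A \<subseteq> space M" "B \<subseteq> space M"
  shows "outer_measure_of M (A \<union> B) \<le> outer_measure_of M A + outer_measure_of M B"
proof -
  obtain E F where "E \<in> sets M" "A \<subseteq> E" "outer_measure_of M A = emeasure M E"
    and "F \<in> sets M" "B \<subseteq> F" "outer_measure_of M B = emeasure M F"
    using outer_measure_of_attain assms by metis
  moreover have "outer_measure_of M (A \<union> B) \<le> outer_measure_of M (E \<union> F)"
    using calculation by (intro outer_measure_of_mono) auto
  ultimately show ?thesis
    using emeasure_subadditive[of E M F] by (auto intro: order_trans)
qed

lemma prob_space_normal_pair: "prob_space (normal_pair \<mu>1 \<mu>2)"
  unfolding normal_pair_def
  by (intro prob_space_pair prob_space_normal_density) auto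

lemma sets_normal_pair [measurable_cong]: "sets (normal_pair \<mu>1 \<mu>2) = sets borel"
  unfolding normal_pair_def borel_prod[symmetric] by (intro sets_pair_measure_cong) auto

lemma space_normal_pair: "space (normal_pair \<mu>1 \<mu>2) = UNIV"
  using sets_eq_imp_space_eq[OF sets_normal_pair] by simp

lemma lin_comb_nonneg:
  assumes "a \<in> A0 abar" "abar < 1"
  shows "0 \<le> lin_comb a \<rho> z"
  using assms by (auto simp: lin_comb_def A0_def)

text \<open>With \<open>x\<close>, \<open>y\<close> the coordinates of \<open>z\<close> and
  \<open>t = sqrt (1 - \<rho>\<^sup>2)\<close>, the pair
  \<open>(\<rho> * x + t * y, t * x - \<rho> * y)\<close> is an orthogonal image of
  \<open>(x, y)\<close>, so neither component exceeds the length of \<open>z\<close>. The factor 2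
  comes from bounding both weights on \<open>x\<^sup>2\<close> by 1.\<close>

lemma lin_comb_le:
  assumes "a \<in> A0 abar" "abar < 1" "\<bar>\<rho>\<bar> \<le> 1"
  shows "lin_comb a \<rho> z \<le> 2 * ((fst z)\<^sup>2 + (snd z)\<^sup>2)"
proof -
  define x y t where "x = fst z" and "y = snd z" and "t = sqrt (1 - \<rho>\<^sup>2)"
  have t: "\<rho>\<^sup>2 + t\<^sup>2 = 1" using assms(3) by (simp add: t_def abs_square_le_1)
  have "(\<rho> * x + t * y)\<^sup>2 + (t * x - \<rho> * y)\<^sup>2 = (\<rho>\<^sup>2 + t\<^sup>2) * (x\<^sup>2 + y\<^sup>2)"
    by (simp add: power2_eq_square algebra_simps)
  then have "(\<rho> * x + t * y)\<^sup>2 \<le> x\<^sup>2 + y\<^sup>2" using t zero_le_power2[of "t * x - \<rho> * y"] unfolding t mult_1 by linarith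
  then have "snd a * (\<rho> * x + t * y)\<^sup>2 \<le> snd a * (x\<^sup>2 + y\<^sup>2)"
    using assms by (intro mult_left_mono) (auto simp: A0_def)
  moreover have "fst a * x\<^sup>2 \<le> 1 * x\<^sup>2" "snd a * x\<^sup>2 \<le> 1 * x\<^sup>2"
    using assms by (intro mult_right_mono; auto simp: A0_def)+
  moreover have "0 \<le> fst a * y\<^sup>2" "0 \<le> y\<^sup>2" using assms by (auto simp: A0_def)
  ultimately show ?thesis
    unfolding lin_comb_def x_def[symmetric] y_def[symmetric] t_def[symmetric]
      distrib_left left_diff_distrib mult_1
    by linarith
qed

text \<open>The majorant of \<open>lin_comb\<close> depends on neither \<open>a\<close> nor
  \<open>\<rho>\<close>, so a single quantile bound for it serves all critical values.\<close>

lemma crit_bounded: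
  assumes "0 < \<alpha>" "\<alpha> < 1" "abar < 1"
  obtains K where "0 \<le> K" "\<And>a \<rho>. a \<in> A0 abar \<Longrightarrow> \<bar>\<rho>\<bar> \<le> 1 \<Longrightarrow> crit \<alpha> a \<rho> \<le> K"
proof -
  let ?N = "normal_pair 0 0"
  interpret N: prob_space ?N by (rule prob_space_normal_pair)
  \<comment> \<open>These discs exhaust the plane, so one of them has mass above
    \<open>1 - \<alpha>\<close>; its index \<open>k\<close> is the bound.\<close>
  define B where "B k = {z :: real \<times> real. 2 * ((fst z)\<^sup>2 + (snd z)\<^sup>2) \<le> real k}" for k
  have "(\<lambda>k. N.prob (B k)) \<longlonglongrightarrow> N.prob (\<Union>k. B k)"
  proof (rule N.finite_Lim_measure_incseq)
    have "B k \<in> sets borel" for k 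
      unfolding B_def by (intro borel_closed closed_Collect_le continuous_intros)
    then show "range B \<subseteq> N.events" by (auto simp: sets_normal_pair)
    show "incseq B" by (rule incseq_SucI) (auto simp: B_def)
  qed
  moreover have "(\<Union>k. B k) = space ?N"
    using real_arch_simple by (auto simp: B_def space_normal_pair)
  ultimately have "(\<lambda>k. N.prob (B k)) \<longlonglongrightarrow> 1" by (simp add: N.prob_space)
  then have "\<forall>\<^sub>F k in sequentially. 1 - \<alpha> < N.prob (B k)"
    using assms(1) by (intro order_tendstoD) auto
  then obtain k where k: "1 - \<alpha> < N.prob (B k)" using eventually_happens'[OF sequentially_bot] by blast
  have "crit \<alpha> a \<rho> \<le> real k" if a: "a \<in> A0 abar" and "\<bar>\<rho>\<bar> \<le> 1" for a \<rho>
    unfolding crit_def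
  proof (rule cInf_lower)
    have "closed {z. lin_comb a \<rho> z \<le> real k}"
      unfolding lin_comb_def by (intro closed_Collect_le continuous_intros)
    then have "{z \<in> space ?N. lin_comb a \<rho> z \<le> real k} \<in> N.events"
      by (simp add: space_normal_pair sets_normal_pair borel_closed)
    moreover have "B k \<subseteq> {z \<in> space ?N. lin_comb a \<rho> z \<le> real k}"
      by (auto simp: B_def space_normal_pair intro!: order_trans[OF lin_comb_le[OF a assms(3) that(2)]])
    ultimately have "N.prob (B k) \<le> N.prob {z \<in> space ?N. lin_comb a \<rho> z \<le> real k}"
      by (intro N.finite_measure_mono) auto
    then show "real k \<in> {x. 1 - \<alpha> \<le> N.prob {z \<in> space ?N. lin_comb a \<rho> z \<le> x}}" using k by simp
    \<comment> \<open>The infimum of a set of reals is a lower bound only if the set is bounded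
      below. Here \<open>lin_comb\<close> is nonnegative and \<open>1 - \<alpha>\<close> positive,
      which excludes negative levels.\<close>
    show "bdd_below {x. 1 - \<alpha> \<le> N.prob {z \<in> space ?N. lin_comb a \<rho> z \<le> x}}"
    proof (rule bdd_belowI)
      fix x assume x: "x \<in> {x. 1 - \<alpha> \<le> N.prob {z \<in> space ?N. lin_comb a \<rho> z \<le> x}}"
      show "0 \<le> x"
      proof (rule ccontr)
        assume "\<not> 0 \<le> x"
        then have "{z \<in> space ?N. lin_comb a \<rho> z \<le> x} = {}"
          using lin_comb_nonneg[OF a assms(3)] by (auto simp: not_le intro: less_le_trans)
        with x have "1 - \<alpha> \<le> N.prob {}" by (metis (mono_tags) mem_Collect_eq)
        then show False using assms(2) by simp
      qed
    qed
  qed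
  then show ?thesis by (intro that[of "real k"]) auto
qed

section \<open>The constant \<open>c_B\<close> and the lower bound on the first weight\<close>

lemma par_space_det_pos: "r \<in> par_space \<Longrightarrow> 0 < g\<Phi>1 r * g\<Psi> r - (g\<Phi>12 r)\<^sup>2"
  by (simp add: par_space_def)

text \<open>For fixed \<open>r\<close>, \<open>G\<close> is a quadratic polynomial in
  \<open>\<delta>\<close>, hence bounded on the compact set \<open>Dset \<B> \<beta>0\<close>, and
  the supremum is a true upper bound. The value 1 is attained at
  \<open>\<delta> = 0\<close>.\<close>

lemma
  assumes "compact \<B>" "\<beta>0 \<in> \<B>" "r \<in> par_space"
  shows G_squared_le_c_B: "\<delta> \<in> Dset \<B> \<beta>0 \<Longrightarrow> (G \<delta> r)\<^sup>2 \<le> c_B \<B> \<beta>0 r"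
    and c_B_ge_1: "1 \<le> c_B \<B> \<beta>0 r"
proof -
  note det = par_space_det_pos[OF assms(3)]
  have "Dset \<B> \<beta>0 = (\<lambda>b. b - \<beta>0) ` \<B>"
    by (force simp: Dset_def)
  then have "compact (Dset \<B> \<beta>0)"
    using assms(1) by (auto intro!: compact_continuous_image continuous_intros)
  moreover have "continuous_on (Dset \<B> \<beta>0) (\<lambda>\<delta>. (G \<delta> r)\<^sup>2)"
    using det by (auto simp: G_def proj13_eq intro!: continuous_intros)
  ultimately have "bdd_above ((\<lambda>\<delta>. (G \<delta> r)\<^sup>2) ` Dset \<B> \<beta>0)"
    by (intro bounded_imp_bdd_above compact_imp_bounded compact_continuous_image)
  then show le: "(G \<delta> r)\<^sup>2 \<le> c_B \<B> \<beta>0 r" if "\<delta> \<in> Dset \<B> \<beta>0" for \<delta>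
    unfolding c_B_def using that by (intro cSUP_upper)
  have "0 \<in> Dset \<B> \<beta>0" using assms(2) by (simp add: Dset_def)
  from le[OF this] show "1 \<le> c_B \<B> \<beta>0 r"
    using det by (simp add: G_def proj13_eq)
qed

text \<open>A first weight of 0.01 suffices by the assumption on \<open>AR_stat\<close>. A smaller
  one is at least \<open>C / \<mu>\<^sup>2\<close>, where the factor \<open>g\<Phi>1 r\<close> of
  \<open>C\<close> cancels the variance in the squared \<open>AR_stat\<close>, and the bound on
  \<open>\<mu>\<^sup>2\<close> leaves at least \<open>crit_max\<close>.\<close>

lemma crit_le_weighted_AR:
  assumes r: "r \<in> par_space" and a: "a \<in> weight_set \<alpha> abar \<B> \<beta>0 \<mu> r"
    and crit: "crit \<alpha> a (g\<rho> r) \<le> crit_max \<alpha> abar (g\<rho> r)"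
    and AR: "crit_max \<alpha> abar (g\<rho> r) \<le> 0.01 * (AR_stat r qee)\<^sup>2"
    and c_B: "0 < c_B \<B> \<beta>0 r" and \<rho>: "g\<rho> r \<noteq> 0"
    and \<mu>: "\<mu>\<^sup>2 \<le> 1.1 * c_B \<B> \<beta>0 r * ((g\<Psi> r)\<^sup>2 * (g\<rho> r)^4 / (g\<Phi>1 r)\<^sup>2) * qee\<^sup>2"
  shows "crit \<alpha> a (g\<rho> r) \<le> fst a * (AR_stat r qee)\<^sup>2"
proof (cases "0 < crit_max \<alpha> abar (g\<rho> r)")
  case False
  moreover have "0 \<le> fst a" using a by (simp add: weight_set_def A0_def)
  ultimately show ?thesis using crit by (smt (verit) mult_nonneg_nonneg zero_le_power2)
next
  case True
  define m where "m = crit_max \<alpha> abar (g\<rho> r)"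
  define \<kappa> where "\<kappa> = (g\<Psi> r)\<^sup>2 * (g\<rho> r)^4 / (g\<Phi>1 r)\<^sup>2"
  define C where "C = 1.1 * m * g\<Phi>1 r * c_B \<B> \<beta>0 r * \<kappa>"
  have pos: "0 < g\<Phi>1 r" "0 < g\<Psi> r" using r by (auto simp: par_space_def)
  have "0 < C" using True pos c_B \<rho> by (auto simp: C_def \<kappa>_def m_def)
  have "a_lower \<alpha> abar \<B> \<beta>0 \<mu> r = (if \<mu> = 0 \<and> 0 < C then 0.01 else min 0.01 (C / \<mu>\<^sup>2))"
    by (simp only: a_lower_def Let_def C_def \<kappa>_def m_def)
  with \<open>0 < C\<close> have low: "(if \<mu> = 0 then 0.01 else min 0.01 (C / \<mu>\<^sup>2)) \<le> fst a"
    using a by (simp add: weight_set_def)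
  have "m \<le> fst a * (AR_stat r qee)\<^sup>2"
  proof (cases "0.01 \<le> fst a")
    case True
    then have "0.01 * (AR_stat r qee)\<^sup>2 \<le> fst a * (AR_stat r qee)\<^sup>2" by (intro mult_right_mono) auto
    then show ?thesis using AR by (simp add: m_def)
  next
    case False
    \<comment> \<open>A first weight below 0.01 excludes the branch \<open>\<mu> = 0\<close> and
      forces the minimum to be \<open>C / \<mu>\<^sup>2\<close>.\<close>
    then have "\<mu> \<noteq> 0" "C / \<mu>\<^sup>2 \<le> fst a" using low by (auto split: if_splits)
    have "m * \<mu>\<^sup>2 \<le> m * (1.1 * c_B \<B> \<beta>0 r * \<kappa> * qee\<^sup>2)"
      using \<mu> True unfolding \<kappa>_def m_def by (intro mult_left_mono) auto
    also have "\<dots> = C * (AR_stat r qee)\<^sup>2"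
      using pos by (simp add: C_def AR_stat_def power_divide)
    finally have "m \<le> C / \<mu>\<^sup>2 * (AR_stat r qee)\<^sup>2" using \<open>\<mu> \<noteq> 0\<close> by (simp add: field_simps)
    also have "\<dots> \<le> fst a * (AR_stat r qee)\<^sup>2"
      using \<open>C / \<mu>\<^sup>2 \<le> fst a\<close> by (intro mult_right_mono) auto
    finally show ?thesis .
  qed
  then show ?thesis using crit by (simp add: m_def)
qed

section \<open>Continuity in the parameter vector\<close>

lemma tendsto_gpar [tendsto_intros]:
  "(g\<Phi>1 \<longlongrightarrow> g\<Phi>1 r) (nhds r)" "(g\<Phi>12 \<longlongrightarrow> g\<Phi>12 r) (nhds r)" "(g\<Phi>13 \<longlongrightarrow> g\<Phi>13 r) (nhds r)"
  "(g\<Psi> \<longlongrightarrow> g\<Psi> r) (nhds r)" "(g\<tau> \<longlongrightarrow> g\<tau> r) (nhds r)" "(g\<Upsilon> \<longlongrightarrow> g\<Upsilon> r) (nhds r)"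
  "(g\<rho> \<longlongrightarrow> g\<rho> r) (nhds r)"
  unfolding gpar_eq_projections[abs_def] by (intro tendsto_intros filterlim_ident)+

text \<open>The set is cut out by strict inequalities between continuous functions. Estimates near
  \<open>r0\<close> must lie in it because \<open>minimax_weights\<close> specifies the weights only
  there.\<close>

lemma eventually_par_space:
  assumes "r0 \<in> par_space"
  shows "\<forall>\<^sub>F r in nhds r0. r \<in> par_space"
proof -
  have "\<forall>\<^sub>F r in nhds r0. 0 < g\<Phi>1 r" "\<forall>\<^sub>F r in nhds r0. 0 < g\<Psi> r" "\<forall>\<^sub>F r in nhds r0. 0 < g\<Upsilon> r"
    "\<forall>\<^sub>F r in nhds r0. -1 < g\<rho> r" "\<forall>\<^sub>F r in nhds r0. g\<rho> r < 1"
    "\<forall>\<^sub>F r in nhds r0. 0 < g\<Phi>1 r * g\<Psi> r - (g\<Phi>12 r)\<^sup>2"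
    using assms unfolding par_space_def
    by (auto intro!: order_tendstoD tendsto_intros simp del: diff_gt_0_iff_gt)
  then show ?thesis by eventually_elim (simp add: par_space_def)
qed

section \<open>Deterministic conditions for rejection\<close>

text \<open>All three summands of the statistic are nonnegative, so one large summand is enough:
  \<open>LMstar_stat\<close> has weight at least \<open>1 - abar\<close>, while for
  \<open>AR_stat\<close> the lower bound on the first weight is used.\<close>

lemma CLC_test_eq_1:
  assumes weights: "minimax_weights \<alpha> abar \<B> \<beta>0 a" and abar: "abar < 1"
    and crit: "\<And>a \<rho>. a \<in> A0 abar \<Longrightarrow> \<bar>\<rho>\<bar> \<le> 1 \<Longrightarrow> crit \<alpha> a \<rho> \<le> K"
    and r: "r \<in> par_space"
  shows CLC_test_eq_1_LMstar:
      "K \<le> (1 - abar) * (LMstar_stat r qee qxe)\<^sup>2 \<Longrightarrow> CLC_test \<alpha> a s r qee qxe qxx = 1"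
    and CLC_test_eq_1_AR:
      "\<lbrakk>K \<le> 0.01 * (AR_stat r qee)\<^sup>2; 0 < c_B \<B> \<beta>0 r; g\<rho> r \<noteq> 0;
        (D_stat r qee qxe qxx)\<^sup>2 \<le> 1.1 * c_B \<B> \<beta>0 r * ((g\<Psi> r)\<^sup>2 * (g\<rho> r)^4 / (g\<Phi>1 r)\<^sup>2) * qee\<^sup>2\<rbrakk>
       \<Longrightarrow> CLC_test \<alpha> a s r qee qxe qxx = 1"
proof -
  define \<mu> where "\<mu> = shrink s (D_stat r qee qxe qxx) r"
  define w where "w = a \<mu> r"
  have w: "w \<in> weight_set \<alpha> abar \<B> \<beta>0 \<mu> r"
    using weights r by (simp add: minimax_weights_def is_arg_min_def w_def)
  then have w': "w \<in> A0 abar" "0 \<le> fst w" "0 \<le> snd w" "1 - abar \<le> 1 - fst w - snd w"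
    by (auto simp: weight_set_def A0_def)
  have \<rho>: "\<bar>g\<rho> r\<bar> \<le> 1" using r by (auto simp: par_space_def)
  have eq: "CLC_test \<alpha> a s r qee qxe qxx = of_bool (crit \<alpha> w (g\<rho> r) \<le>
    fst w * (AR_stat r qee)\<^sup>2 + snd w * (LM_stat r qxe)\<^sup>2 + (1 - fst w - snd w) * (LMstar_stat r qee qxe)\<^sup>2)"
    by (simp add: CLC_test_def Let_def w_def \<mu>_def)
  have nonneg: "0 \<le> fst w * (AR_stat r qee)\<^sup>2" "0 \<le> snd w * (LM_stat r qxe)\<^sup>2"
    "(1 - abar) * (LMstar_stat r qee qxe)\<^sup>2 \<le> (1 - fst w - snd w) * (LMstar_stat r qee qxe)\<^sup>2"
    "0 \<le> (1 - abar) * (LMstar_stat r qee qxe)\<^sup>2"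
    using w' abar by (auto intro: mult_right_mono)
  show "CLC_test \<alpha> a s r qee qxe qxx = 1" if "K \<le> (1 - abar) * (LMstar_stat r qee qxe)\<^sup>2"
    using crit[OF w'(1) \<rho>] nonneg that by (simp add: eq)
  assume AR: "K \<le> 0.01 * (AR_stat r qee)\<^sup>2" and "0 < c_B \<B> \<beta>0 r" "g\<rho> r \<noteq> 0"
    and D: "(D_stat r qee qxe qxx)\<^sup>2 \<le> 1.1 * c_B \<B> \<beta>0 r * ((g\<Psi> r)\<^sup>2 * (g\<rho> r)^4 / (g\<Phi>1 r)\<^sup>2) * qee\<^sup>2"
  have "bdd_above ((\<lambda>a. crit \<alpha> a (g\<rho> r)) ` A0 abar)"
    using crit[OF _ \<rho>] by (intro bdd_aboveI[of _ K]) auto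
  then have "crit \<alpha> w (g\<rho> r) \<le> crit_max \<alpha> abar (g\<rho> r)"
    unfolding crit_max_def using w'(1) by (intro cSUP_upper)
  moreover have "crit_max \<alpha> abar (g\<rho> r) \<le> K"
    unfolding crit_max_def using w'(1) crit[OF _ \<rho>] by (intro cSUP_least) auto
  \<comment> \<open>Shrinkage lets the assumption on \<open>D_stat\<close> pass to the argument
    \<open>\<mu>\<close> of the weights.\<close>
  moreover have "\<mu>\<^sup>2 \<le> (D_stat r qee qxe qxx)\<^sup>2" unfolding \<mu>_def by (rule shrink_squared_le)
  ultimately have "crit \<alpha> w (g\<rho> r) \<le> fst w * (AR_stat r qee)\<^sup>2"
    using AR D \<open>0 < c_B \<B> \<beta>0 r\<close> \<open>g\<rho> r \<noteq> 0\<close>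
    by (intro crit_le_weighted_AR[OF r w]) (assumption | linarith)+
  then show "CLC_test \<alpha> a s r qee qxe qxx = 1" using nonneg by (simp add: eq)
qed

text \<open>The statistic is linear in \<open>(qee, qxe)\<close>: its deviation from
  \<open>C\<close> times the value at \<open>(\<Delta>\<^sup>2, \<Delta>)\<close> is its value at
  the two errors.\<close>

lemma LMstar_stat_ge:
  assumes "\<bar>qee - \<Delta>\<^sup>2 * C\<bar> \<le> L" "\<bar>qxe - \<Delta> * C\<bar> \<le> L" "r \<in> par_space"
  shows "\<bar>C\<bar> * \<bar>LMstar_stat r (\<Delta>\<^sup>2) \<Delta>\<bar>
      - L * ((1 / sqrt (g\<Psi> r) + \<bar>g\<rho> r\<bar> / sqrt (g\<Phi>1 r)) / sqrt (1 - (g\<rho> r)\<^sup>2))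
    \<le> \<bar>LMstar_stat r qee qxe\<bar>"
proof -
  have pos: "0 < g\<Phi>1 r" "0 < g\<Psi> r" "\<bar>g\<rho> r\<bar> < 1" using assms(3) by (auto simp: par_space_def)
  then have \<rho>: "0 < sqrt (1 - (g\<rho> r)\<^sup>2)" by (simp add: abs_square_less_1)
  define x y where "x = qee - \<Delta>\<^sup>2 * C" and "y = qxe - \<Delta> * C"
  have "LMstar_stat r qee qxe - C * LMstar_stat r (\<Delta>\<^sup>2) \<Delta>
      = (y / sqrt (g\<Psi> r) - g\<rho> r * (x / sqrt (g\<Phi>1 r))) / sqrt (1 - (g\<rho> r)\<^sup>2)"
    by (simp add: LMstar_stat_def LM_stat_def AR_stat_def x_def y_def algebra_simps diff_divide_distrib
        add_divide_distrib)
  also have "\<bar>\<dots>\<bar> \<le> (\<bar>y / sqrt (g\<Psi> r)\<bar> + \<bar>g\<rho> r * (x / sqrt (g\<Phi>1 r))\<bar>) / sqrt (1 - (g\<rho> r)\<^sup>2)"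
    unfolding abs_divide[of _ "sqrt (1 - (g\<rho> r)\<^sup>2)"] abs_of_pos[OF \<rho>]
    by (intro divide_right_mono abs_triangle_ineq4 less_imp_le[OF \<rho>])
  also have "\<dots> \<le> (L / sqrt (g\<Psi> r) + \<bar>g\<rho> r\<bar> * (L / sqrt (g\<Phi>1 r))) / sqrt (1 - (g\<rho> r)\<^sup>2)"
    using assms(1,2) pos \<rho> unfolding x_def[symmetric] y_def[symmetric]
    by (intro divide_right_mono add_mono)
      (auto simp: abs_mult intro!: divide_right_mono mult_left_mono)
  also have "\<dots> = L * ((1 / sqrt (g\<Psi> r) + \<bar>g\<rho> r\<bar> / sqrt (g\<Phi>1 r)) / sqrt (1 - (g\<rho> r)\<^sup>2))"
    by (simp add: algebra_simps)
  finally have "\<bar>LMstar_stat r qee qxe - C * LMstar_stat r (\<Delta>\<^sup>2) \<Delta>\<bar> \<le> \<dots>" .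
  then show ?thesis unfolding abs_mult[symmetric] by linarith
qed

text \<open>At the error-free point \<open>(\<Delta>\<^sup>2 * C, \<Delta> * C, C)\<close> the
  statistic equals \<open>C * G \<Delta> r\<close>; the remainder is linear in the errors.\<close>

lemma D_stat_le:
  assumes "\<bar>qee - \<Delta>\<^sup>2 * C\<bar> \<le> L" "\<bar>qxe - \<Delta> * C\<bar> \<le> L" "\<bar>qxx - C\<bar> \<le> L" and r: "r \<in> par_space"
  shows "\<bar>D_stat r qee qxe qxx\<bar> \<le> \<bar>C\<bar> * \<bar>G \<Delta> r\<bar> + L * (1 +
    (\<bar>g\<Psi> r * g\<Phi>13 r - g\<Phi>12 r * g\<tau> r\<bar> + \<bar>g\<Phi>1 r * g\<tau> r - g\<Phi>12 r * g\<Phi>13 r\<bar>)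
      / (g\<Phi>1 r * g\<Psi> r - (g\<Phi>12 r)\<^sup>2))"
proof -
  let ?d = "g\<Phi>1 r * g\<Psi> r - (g\<Phi>12 r)\<^sup>2"
  let ?u = "g\<Psi> r * g\<Phi>13 r - g\<Phi>12 r * g\<tau> r" and ?v = "g\<Phi>1 r * g\<tau> r - g\<Phi>12 r * g\<Phi>13 r"
  have d: "0 < ?d" using r by (rule par_space_det_pos)
  then have proj: "proj13 r x y = (x * ?u + y * ?v) / ?d" for x y by (simp add: proj13_eq)
  define x y where "x = qee - \<Delta>\<^sup>2 * C" and "y = qxe - \<Delta> * C"
  have "D_stat r qee qxe qxx = C * G \<Delta> r + (qxx - C) - (x * ?u + y * ?v) / ?d"
    using d unfolding D_stat_def G_def proj x_def y_def
    by (simp add: diff_divide_distrib add_divide_distrib algebra_simps)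
  moreover have "\<bar>(x * ?u + y * ?v) / ?d\<bar> \<le> L * ((\<bar>?u\<bar> + \<bar>?v\<bar>) / ?d)"
  proof -
    have "\<bar>x * ?u + y * ?v\<bar> \<le> \<bar>x\<bar> * \<bar>?u\<bar> + \<bar>y\<bar> * \<bar>?v\<bar>" by (metis abs_mult abs_triangle_ineq)
    also have "\<dots> \<le> L * \<bar>?u\<bar> + L * \<bar>?v\<bar>"
      using assms unfolding x_def[symmetric] y_def[symmetric] by (intro add_mono mult_right_mono) auto
    finally show ?thesis using d by (simp add: divide_right_mono flip: distrib_left)
  qed
  moreover have "\<bar>C * G \<Delta> r\<bar> = \<bar>C\<bar> * \<bar>G \<Delta> r\<bar>" by (rule abs_mult)
  ultimately show ?thesis using assms(3) unfolding distrib_left by linarith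
qed

section \<open>Rejection near the limit for large concentration\<close>

text \<open>The slope and error coefficient of \<open>LMstar_stat_ge\<close> are continuous at
  \<open>r0\<close>, so the slope stays above half its limit. Neither the threshold \<open>c\<close>
  nor the neighbourhood depends on \<open>C\<close>, so both can be fixed before the sample
  size.\<close>

lemma eventually_CLC_test_eq_1_LMstar:
  assumes weights: "minimax_weights \<alpha> abar \<B> \<beta>0 a" and level: "0 < \<alpha>" "\<alpha> < 1" and abar: "abar < 1"
    and r0: "r0 \<in> par_space" and nz: "LMstar_stat r0 (\<Delta>\<^sup>2) \<Delta> \<noteq> 0"
  shows "\<exists>c. \<forall>\<^sub>F r in nhds r0. \<forall>C qee qxe qxx. c \<le> \<bar>C\<bar> \<longrightarrow>
    \<bar>qee - \<Delta>\<^sup>2 * C\<bar> \<le> L \<longrightarrow> \<bar>qxe - \<Delta> * C\<bar> \<le> L \<longrightarrow> \<bar>qxx - C\<bar> \<le> L \<longrightarrow>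
    CLC_test \<alpha> a s r qee qxe qxx = 1"
proof -
  obtain K where K: "0 \<le> K" and crit: "\<And>a \<rho>. a \<in> A0 abar \<Longrightarrow> \<bar>\<rho>\<bar> \<le> 1 \<Longrightarrow> crit \<alpha> a \<rho> \<le> K"
    using crit_bounded[OF level abar] by blast
  define k where "k r = \<bar>LMstar_stat r (\<Delta>\<^sup>2) \<Delta>\<bar>" for r
  define b where "b r = (1 / sqrt (g\<Psi> r) + \<bar>g\<rho> r\<bar> / sqrt (g\<Phi>1 r)) / sqrt (1 - (g\<rho> r)\<^sup>2)" for r
  \<comment> \<open>The size of \<open>LMstar_stat\<close> at which its guaranteed weight
    \<open>1 - abar\<close> already yields \<open>K\<close>.\<close>
  define m where "m = sqrt (K / (1 - abar))"
  have "0 < k r0" using nz by (simp add: k_def)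
  have "0 < g\<Phi>1 r0" "0 < g\<Psi> r0" "0 < 1 - (g\<rho> r0)\<^sup>2"
    using r0 by (auto simp: par_space_def abs_square_less_1)
  then have lim: "(k \<longlongrightarrow> k r0) (nhds r0)" "(b \<longlongrightarrow> b r0) (nhds r0)"
    unfolding k_def b_def LMstar_stat_def LM_stat_def AR_stat_def
    by (intro tendsto_intros; simp)+
  have ev: "\<forall>\<^sub>F r in nhds r0. k r0 / 2 < k r" "\<forall>\<^sub>F r in nhds r0. b r < b r0 + 1"
    using \<open>0 < k r0\<close> order_tendstoD(1)[OF lim(1), of "k r0 / 2"] order_tendstoD(2)[OF lim(2), of "b r0 + 1"]
    by simp_all
  have "\<forall>\<^sub>F r in nhds r0. \<forall>C qee qxe qxx. (m + \<bar>L\<bar> * (b r0 + 1)) / (k r0 / 2) \<le> \<bar>C\<bar> \<longrightarrow>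
    \<bar>qee - \<Delta>\<^sup>2 * C\<bar> \<le> L \<longrightarrow> \<bar>qxe - \<Delta> * C\<bar> \<le> L \<longrightarrow> \<bar>qxx - C\<bar> \<le> L \<longrightarrow>
    CLC_test \<alpha> a s r qee qxe qxx = 1"
    using eventually_par_space[OF r0] ev
  proof eventually_elim
    case (elim r)
    show ?case
    proof (intro allI impI)
      fix C qee qxe qxx
      assume C: "(m + \<bar>L\<bar> * (b r0 + 1)) / (k r0 / 2) \<le> \<bar>C\<bar>"
        and L: "\<bar>qee - \<Delta>\<^sup>2 * C\<bar> \<le> L" "\<bar>qxe - \<Delta> * C\<bar> \<le> L"
      have "m + \<bar>L\<bar> * (b r0 + 1) \<le> \<bar>C\<bar> * (k r0 / 2)"
        using C \<open>0 < k r0\<close> by (simp add: field_simps)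
      also have "\<dots> \<le> \<bar>C\<bar> * k r" using elim(2) by (intro mult_left_mono) auto
      finally have "m + \<bar>L\<bar> * (b r0 + 1) \<le> \<bar>C\<bar> * k r" .
      moreover have "0 < g\<Phi>1 r" "0 < g\<Psi> r" "\<bar>g\<rho> r\<bar> \<le> 1" using elim(1) by (auto simp: par_space_def)
      then have "0 \<le> b r"
        unfolding b_def
        by (intro divide_nonneg_nonneg add_nonneg_nonneg) (auto simp: abs_square_le_1)
      then have "L * b r \<le> \<bar>L\<bar> * (b r0 + 1)"
        using elim(3) by (intro mult_mono) auto
      moreover have "\<bar>C\<bar> * k r - L * b r \<le> \<bar>LMstar_stat r qee qxe\<bar>"
        using LMstar_stat_ge[OF L elim(1)] by (simp add: k_def b_def)
      ultimately have "m \<le> \<bar>LMstar_stat r qee qxe\<bar>" by linarith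
      then have "K / (1 - abar) \<le> (LMstar_stat r qee qxe)\<^sup>2"
        using sqrt_le_D[of "K / (1 - abar)" "\<bar>LMstar_stat r qee qxe\<bar>"] by (simp add: m_def)
      then have "K \<le> (1 - abar) * (LMstar_stat r qee qxe)\<^sup>2" using abar by (simp add: field_simps)
      then show "CLC_test \<alpha> a s r qee qxe qxx = 1"
        using CLC_test_eq_1_LMstar[OF weights abar _ elim(1)] crit by blast
    qed
  qed
  then show ?thesis by blast
qed

text \<open>
  The slack \<open>1.1 = p\<^sub>2\<close> is split as \<open>1.1 / 1.05 \<ge> 1.02\<^sup>2\<close>: the factor \<open>1.05\<close> pays for the estimation error
  in \<open>1 / \<Delta>\<^sub>*^4\<close>, the factor \<open>1.02\<close> for the bounded errors in the quadratic forms.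
\<close>

lemma eventually_CLC_test_eq_1_AR:
  assumes weights: "minimax_weights \<alpha> abar \<B> \<beta>0 a" and level: "0 < \<alpha>" "\<alpha> < 1" and abar: "abar < 1"
    and \<B>: "compact \<B>" "\<beta>0 \<in> \<B>" "\<Delta> + \<beta>0 \<in> \<B>" "\<Delta> \<noteq> 0"
    and r0: "r0 \<in> par_space" and zero: "LMstar_stat r0 (\<Delta>\<^sup>2) \<Delta> = 0"
  shows "\<exists>c. \<forall>\<^sub>F r in nhds r0. \<forall>C qee qxe qxx. c \<le> \<bar>C\<bar> \<longrightarrow>
    \<bar>qee - \<Delta>\<^sup>2 * C\<bar> \<le> L \<longrightarrow> \<bar>qxe - \<Delta> * C\<bar> \<le> L \<longrightarrow> \<bar>qxx - C\<bar> \<le> L \<longrightarrow>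
    CLC_test \<alpha> a s r qee qxe qxx = 1"
proof -
  obtain K where K: "0 \<le> K" and crit: "\<And>a \<rho>. a \<in> A0 abar \<Longrightarrow> \<bar>\<rho>\<bar> \<le> 1 \<Longrightarrow> crit \<alpha> a \<rho> \<le> K"
    using crit_bounded[OF level abar] by blast
  define \<kappa> where "\<kappa> r = (g\<Psi> r)\<^sup>2 * (g\<rho> r)^4 / (g\<Phi>1 r)\<^sup>2" for r
  define m where "m r = (\<bar>g\<Psi> r * g\<Phi>13 r - g\<Phi>12 r * g\<tau> r\<bar> + \<bar>g\<Phi>1 r * g\<tau> r - g\<Phi>12 r * g\<Phi>13 r\<bar>)
      / (g\<Phi>1 r * g\<Psi> r - (g\<Phi>12 r)\<^sup>2)" for r
  have pos: "0 < g\<Phi>1 r0" "0 < g\<Psi> r0" "0 < 1 - (g\<rho> r0)\<^sup>2"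
    using r0 by (auto simp: par_space_def abs_square_less_1)
  \<comment> \<open>A vanishing \<open>LMstar_stat\<close> means
    \<open>\<Delta> = \<Delta>\<^sub>*\<close>, so \<open>1 / \<Delta>\<^sub>*^4\<close>, which is
    \<open>\<kappa> r0\<close>, equals \<open>1 / \<Delta>^4\<close>.\<close>
  have "\<Delta> / sqrt (g\<Psi> r0) = g\<rho> r0 * (\<Delta>\<^sup>2 / sqrt (g\<Phi>1 r0))"
    using zero pos by (simp add: LMstar_stat_def LM_stat_def AR_stat_def)
  then have "sqrt (g\<Phi>1 r0) = \<Delta> * g\<rho> r0 * sqrt (g\<Psi> r0)"
    using pos \<B>(4) by (simp add: field_simps power2_eq_square)
  then have "g\<Phi>1 r0 = (\<Delta> * g\<rho> r0 * sqrt (g\<Psi> r0))\<^sup>2"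
    using pos by (metis less_imp_le real_sqrt_pow2)
  then have \<Phi>1: "g\<Phi>1 r0 = \<Delta>\<^sup>2 * (g\<rho> r0)\<^sup>2 * g\<Psi> r0"
    using pos by (simp add: power_mult_distrib)
  then have "g\<rho> r0 \<noteq> 0" using pos by auto
  then have "\<kappa> r0 = 1 / \<Delta>^4" using pos \<B>(4) by (simp add: \<kappa>_def \<Phi>1 power_mult_distrib)
  moreover have "(\<kappa> \<longlongrightarrow> \<kappa> r0) (nhds r0)" "(m \<longlongrightarrow> m r0) (nhds r0)"
    using pos par_space_det_pos[OF r0] unfolding \<kappa>_def m_def by (auto intro!: tendsto_intros)
  ultimately have ev: "\<forall>\<^sub>F r in nhds r0. 1 / \<Delta>^4 / 1.05 < \<kappa> r" "\<forall>\<^sub>F r in nhds r0. m r < m r0 + 1"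
    "\<forall>\<^sub>F r in nhds r0. g\<Phi>1 r < g\<Phi>1 r0 + 1" "\<forall>\<^sub>F r in nhds r0. g\<rho> r \<noteq> 0"
    using \<B>(4) \<open>g\<rho> r0 \<noteq> 0\<close>
    by (auto intro!: order_tendstoD tendsto_imp_eventually_ne tendsto_intros simp: divide_simps)
  \<comment> \<open>Errors on the scale of \<open>\<bar>C\<bar>\<close>: \<open>l\<close> is the
    loss in \<open>\<bar>qee\<bar> / \<Delta>\<^sup>2\<close>, and \<open>l'\<close> bounds the
    additive error of \<open>D_stat\<close> for \<open>r\<close> near \<open>r0\<close>.\<close>
  define l where "l = \<bar>L\<bar> / \<Delta>\<^sup>2"
  define l' where "l' = \<bar>L\<bar> * (1 + (m r0 + 1))"
  \<comment> \<open>The first entry makes the squared \<open>AR_stat\<close>, times 0.01, at least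
    \<open>K\<close>. The second is equivalent to
    \<open>\<bar>C\<bar> + l' \<le> 1.02 * (\<bar>C\<bar> - l)\<close>, as
    \<open>50 = 1 / 0.02\<close>.\<close>
  define c where "c = max (l + sqrt (100 * K * (g\<Phi>1 r0 + 1)) / \<Delta>\<^sup>2) (50 * (l' + 1.02 * l))"
  have "\<forall>\<^sub>F r in nhds r0. \<forall>C qee qxe qxx. c \<le> \<bar>C\<bar> \<longrightarrow>
    \<bar>qee - \<Delta>\<^sup>2 * C\<bar> \<le> L \<longrightarrow> \<bar>qxe - \<Delta> * C\<bar> \<le> L \<longrightarrow> \<bar>qxx - C\<bar> \<le> L \<longrightarrow>
    CLC_test \<alpha> a s r qee qxe qxx = 1"
    using eventually_par_space[OF r0] ev
  proof eventually_elim
    case (elim r)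
    show ?case
    proof (intro allI impI)
      fix C qee qxe qxx
      assume C: "c \<le> \<bar>C\<bar>"
        and L: "\<bar>qee - \<Delta>\<^sup>2 * C\<bar> \<le> L" "\<bar>qxe - \<Delta> * C\<bar> \<le> L" "\<bar>qxx - C\<bar> \<le> L"
      have r: "0 < g\<Phi>1 r" "0 \<le> m r"
        using elim(1) par_space_det_pos[OF elim(1)] by (auto simp: par_space_def m_def)
      define cB where "cB = c_B \<B> \<beta>0 r"
      have cB: "1 \<le> cB" "(G \<Delta> r)\<^sup>2 \<le> cB"
        using c_B_ge_1[OF \<B>(1,2) elim(1)] G_squared_le_c_B[OF \<B>(1,2) elim(1), of \<Delta>] \<B>(3)
        by (auto simp: cB_def Dset_def)
      have C1: "sqrt (100 * K * (g\<Phi>1 r0 + 1)) / \<Delta>\<^sup>2 \<le> \<bar>C\<bar> - l" and C2: "\<bar>C\<bar> + l' \<le> 1.02 * (\<bar>C\<bar> - l)"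
        using C by (auto simp: c_def)
      have "0 \<le> sqrt (100 * K * (g\<Phi>1 r0 + 1)) / \<Delta>\<^sup>2" using K pos(1) by simp
      then have "0 \<le> \<bar>C\<bar> - l" using C1 by linarith
      have "\<Delta>\<^sup>2 * \<bar>C\<bar> - L \<le> \<bar>qee\<bar>"
        using L(1) abs_mult[of "\<Delta>\<^sup>2" C] by simp
      moreover have "\<Delta>\<^sup>2 * l = L" using L(1) \<B>(4) by (simp add: l_def)
      ultimately have "\<Delta>\<^sup>2 * (\<bar>C\<bar> - l) \<le> \<bar>qee\<bar>" by (simp add: algebra_simps)
      then have "(\<Delta>\<^sup>2 * (\<bar>C\<bar> - l))\<^sup>2 \<le> \<bar>qee\<bar>\<^sup>2"
        using \<open>0 \<le> \<bar>C\<bar> - l\<close> by (intro power_mono) auto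
      then have qee: "\<Delta>^4 * (\<bar>C\<bar> - l)\<^sup>2 \<le> qee\<^sup>2" by (simp add: power_mult_distrib)
      have "sqrt (100 * K * (g\<Phi>1 r0 + 1)) \<le> \<bar>qee\<bar>"
        using C1 \<B>(4) \<open>\<Delta>\<^sup>2 * (\<bar>C\<bar> - l) \<le> \<bar>qee\<bar>\<close> by (simp add: field_simps)
      then have "100 * K * (g\<Phi>1 r0 + 1) \<le> qee\<^sup>2" using sqrt_le_D by fastforce
      moreover have "100 * K * g\<Phi>1 r \<le> 100 * K * (g\<Phi>1 r0 + 1)"
        using elim(4) K by (intro mult_left_mono) auto
      ultimately have AR: "K \<le> 0.01 * (AR_stat r qee)\<^sup>2"
        using r(1) by (simp add: AR_stat_def power_divide field_simps)
      have "\<bar>D_stat r qee qxe qxx\<bar> \<le> \<bar>C\<bar> * \<bar>G \<Delta> r\<bar> + L * (1 + m r)"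
        using D_stat_le[OF L elim(1)] by (simp add: m_def)
      \<comment> \<open>Because \<open>cB \<ge> 1\<close>, the additive error is absorbed into the
        same factor \<open>sqrt cB\<close> as the main term.\<close>
      also have "\<dots> \<le> \<bar>C\<bar> * sqrt cB + l' * sqrt cB"
      proof (intro add_mono mult_left_mono)
        show "\<bar>G \<Delta> r\<bar> \<le> sqrt cB" using cB(2) by (intro real_le_rsqrt) auto
        have "L * (1 + m r) \<le> l'"
          unfolding l'_def using elim(3) r(2) by (intro mult_mono) auto
        also have "\<dots> \<le> l' * sqrt cB"
          using mult_left_mono[of 1 "sqrt cB" l'] cB(1) elim(3) r(2) by (simp add: l'_def)
        finally show "L * (1 + m r) \<le> l' * sqrt cB" .
      qed auto
      also have "\<dots> = sqrt cB * (\<bar>C\<bar> + l')" by (simp add: algebra_simps)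
      also have "\<dots> \<le> sqrt cB * (1.02 * (\<bar>C\<bar> - l))" using C2 cB(1) by (intro mult_left_mono) auto
      finally have "\<bar>D_stat r qee qxe qxx\<bar>\<^sup>2 \<le> (sqrt cB * (1.02 * (\<bar>C\<bar> - l)))\<^sup>2"
        by (intro power_mono) auto
      also have "\<dots> = cB * (1.02\<^sup>2 * (\<bar>C\<bar> - l)\<^sup>2)" using cB(1) by (simp only: power_mult_distrib) simp
      also have "\<dots> \<le> cB * (1.1 * \<kappa> r * qee\<^sup>2)"
      proof (rule mult_left_mono)
        have "1.02\<^sup>2 * (\<bar>C\<bar> - l)\<^sup>2 \<le> 1.1 * (1 / 1.05) * (\<bar>C\<bar> - l)\<^sup>2"
          by (intro mult_right_mono) (auto simp: power2_eq_square)
        also have "\<dots> = 1.1 * (1 / \<Delta>^4 / 1.05) * (\<Delta>^4 * (\<bar>C\<bar> - l)\<^sup>2)" using \<B>(4) by simp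
        also have "\<dots> \<le> 1.1 * \<kappa> r * qee\<^sup>2"
          using elim(2) qee by (intro mult_mono) (auto simp: \<kappa>_def)
        finally show "1.02\<^sup>2 * (\<bar>C\<bar> - l)\<^sup>2 \<le> 1.1 * \<kappa> r * qee\<^sup>2" .
      qed (use cB(1) in auto)
      finally have D: "(D_stat r qee qxe qxx)\<^sup>2 \<le> 1.1 * cB * \<kappa> r * qee\<^sup>2" by (simp add: ac_simps)
      show "CLC_test \<alpha> a s r qee qxe qxx = 1"
        using D cB(1) elim(5) AR
        by (intro CLC_test_eq_1_AR[OF weights abar _ elim(1)])
          (auto simp: cB_def \<kappa>_def intro: crit)
    qed
  qed
  then show ?thesis by blast
qed

section \<open>The limiting parameter and convergence in outer probability\<close>

text \<open>Positivity of the variances is read off the infima, and the determinant is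
  \<open>\<Phi>1 * \<Psi> * (1 - \<rho>\<^sup>2)\<close>.\<close>

lemma gamma0_in_par_space:
  assumes "assumption2 M \<B> S \<beta> \<gamma>h" "b \<in> \<B>" "-1 < g\<rho> (gamma0 S \<beta> b)" "g\<rho> (gamma0 S \<beta> b) < 1"
  shows "gamma0 S \<beta> b \<in> par_space"
proof -
  obtain \<Phi>1 \<Phi>12 \<Phi>13 \<Psi> \<tau> \<Upsilon> where S: "S = (\<Phi>1, \<Phi>12, \<Phi>13, \<Psi>, \<tau>, \<Upsilon>)" by (cases S) auto
  define r where "r = gamma0 S \<beta> b"
  have compact: "compact \<B>" using assms(1) by (simp add: assumption2_def)
  \<comment> \<open>A real infimum bounds the individual values only if the image is bounded below,
    which compactness and continuity supply.\<close>
  have bdd: "bdd_below (h ` \<B>)" if "continuous_on \<B> h" for h :: "real \<Rightarrow> real"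
    using compact that by (intro bounded_imp_bdd_below compact_imp_bounded compact_continuous_image)
  have "bdd_below ((\<lambda>b. g\<Phi>1 (gamma0 S \<beta> b)) ` \<B>)" "bdd_below ((\<lambda>b. g\<Psi> (gamma0 S \<beta> b)) ` \<B>)"
    unfolding gamma0_def S gamma_at.simps Let_def g\<Phi>1.simps g\<Psi>.simps
    by (intro bdd continuous_intros)+
  then have "(INF b\<in>\<B>. g\<Phi>1 (gamma0 S \<beta> b)) \<le> g\<Phi>1 r" "(INF b\<in>\<B>. g\<Psi> (gamma0 S \<beta> b)) \<le> g\<Psi> r"
    unfolding r_def using assms(2) by (auto intro: cINF_lower)
  then have pos: "0 < g\<Phi>1 r" "0 < g\<Psi> r" "0 < g\<Upsilon> r"
    using assms(1,2) by (auto simp: assumption2_def r_def)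
  have "g\<rho> r = g\<Phi>12 r / sqrt (g\<Phi>1 r * g\<Psi> r)"
    by (simp add: r_def gamma0_def S Let_def)
  then have "(g\<Phi>12 r)\<^sup>2 = (g\<rho> r)\<^sup>2 * (g\<Phi>1 r * g\<Psi> r)" using pos by (simp add: power_divide)
  moreover have "(g\<rho> r)\<^sup>2 < 1" using assms(3,4) by (simp add: abs_square_less_1 r_def)
  ultimately have "(g\<Phi>12 r)\<^sup>2 < g\<Phi>1 r * g\<Psi> r"
    using pos mult_strict_right_mono[of "(g\<rho> r)\<^sup>2" 1 "g\<Phi>1 r * g\<Psi> r"] by simp
  then show ?thesis using pos assms(3,4) by (simp add: par_space_def r_def)
qed



theorem theorem4p4:
  fixes M :: "nat \<Rightarrow> 'a measure" and K :: "nat \<Rightarrow> nat" and Z :: "nat \<Rightarrow> real mat"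
    and \<Pi>X :: "nat \<Rightarrow> nat \<Rightarrow> real" and V e X Y :: "nat \<Rightarrow> nat \<Rightarrow> 'a \<Rightarrow> real"
    and \<beta> \<beta>0 \<Delta> :: real and \<B> :: "real set"
    and S :: avar and \<gamma>h :: "nat \<Rightarrow> real \<Rightarrow> 'a \<Rightarrow> gpar"
    and \<alpha> abar :: real and a :: "real \<Rightarrow> gpar \<Rightarrow> real \<times> real" and s :: shrinkage
    and Ct :: real and d :: "nat \<Rightarrow> real"
  assumes model: "iv_model M K Z \<Pi>X V e X Y \<beta>"
    and params: "\<beta> \<in> \<B>" "\<beta>0 \<in> \<B>" "\<Delta> = \<beta> - \<beta>0"
    and covariance: "is_covariance S"
    and rho: "\<forall>b\<in>\<B>. -1 < g\<rho> (gamma0 S \<beta> b) \<and> g\<rho> (gamma0 S \<beta> b) < 1"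
    and assumption2: "assumption2 M \<B> S \<beta> \<gamma>h"
    and level: "0 < \<alpha>" "\<alpha> < 1" and abar: "abar < 1"
    and weights: "minimax_weights \<alpha> abar \<B> \<beta>0 a"
    and Op1: "bounded_in_prob M (\<lambda>n \<omega>.
          (Q_ee Z X Y \<beta>0 n \<omega> - \<Delta>\<^sup>2 * conc Z \<Pi>X n,
           Q_Xe Z X Y \<beta>0 n \<omega> - \<Delta> * conc Z \<Pi>X n,
           Q_XX Z X n \<omega> - conc Z \<Pi>X n))"
    and strong_id: "\<forall>\<^sub>F n in sequentially. d n \<noteq> 0 \<and> conc Z \<Pi>X n = Ct / d n"
      "d \<longlonglongrightarrow> 0" "filterlim (\<lambda>n. \<bar>conc Z \<Pi>X n\<bar>) at_top sequentially"
    and fixed_alternative: "\<Delta> \<noteq> 0"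
  shows "conv_in_prob M
    (\<lambda>n \<omega>. CLC_test \<alpha> a s (\<gamma>h n \<beta>0 \<omega>) (Q_ee Z X Y \<beta>0 n \<omega>) (Q_Xe Z X Y \<beta>0 n \<omega>) (Q_XX Z X n \<omega>)) 1"
proof -
  define r0 where "r0 = gamma0 S \<beta> \<beta>0"
  define T where "T n \<omega> = (Q_ee Z X Y \<beta>0 n \<omega> - \<Delta>\<^sup>2 * conc Z \<Pi>X n,
    Q_Xe Z X Y \<beta>0 n \<omega> - \<Delta> * conc Z \<Pi>X n, Q_XX Z X n \<omega> - conc Z \<Pi>X n)" for n \<omega>
  define N where "N n = {\<omega> \<in> space (M n).
    CLC_test \<alpha> a s (\<gamma>h n \<beta>0 \<omega>) (Q_ee Z X Y \<beta>0 n \<omega>) (Q_Xe Z X Y \<beta>0 n \<omega>) (Q_XX Z X n \<omega>) \<noteq> 1}" for n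
  have r0: "r0 \<in> par_space"
    using gamma0_in_par_space[OF assumption2 params(2)] rho params(2) by (simp add: r0_def)
  have \<B>: "compact \<B>" "\<Delta> + \<beta>0 \<in> \<B>" using assumption2 params by (auto simp: assumption2_def)
  have "(\<lambda>n. outer_measure_of (M n) (N n)) \<longlonglongrightarrow> 0"
  proof (rule order_tendstoI)
    fix \<epsilon> :: ennreal assume "0 < \<epsilon>"
    \<comment> \<open>The tolerance is an extended real and may be infinite; a smaller finite one is
      split in halves for the two exceptional events.\<close>
    then obtain x where x: "0 < x" "x < \<epsilon>" using dense by blast
    then have "x < \<top>" by (metis order_less_le_trans top_greatest)
    then obtain \<epsilon>' where "x = ennreal \<epsilon>'" "0 \<le> \<epsilon>'" by (cases x) auto
    then have \<epsilon>': "0 < \<epsilon>'" "ennreal (\<epsilon>' / 2) + ennreal (\<epsilon>' / 2) < \<epsilon>"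
      using x by (auto simp flip: ennreal_plus)
    then obtain L where L: "\<forall>\<^sub>F n in sequentially.
        outer_measure_of (M n) {\<omega> \<in> space (M n). L < norm (T n \<omega>)} < ennreal (\<epsilon>' / 2)"
      using Op1 unfolding bounded_in_prob_def T_def by (meson half_gt_zero)
    \<comment> \<open>Depending on whether \<open>LMstar_stat\<close> vanishes at the limit, one of
      the two rejection lemmas applies; \<open>c\<close> depends on \<open>L\<close> but not on
      \<open>n\<close>.\<close>
    obtain c where "\<forall>\<^sub>F r in nhds r0. \<forall>C qee qxe qxx. c \<le> \<bar>C\<bar> \<longrightarrow>
        \<bar>qee - \<Delta>\<^sup>2 * C\<bar> \<le> L \<longrightarrow> \<bar>qxe - \<Delta> * C\<bar> \<le> L \<longrightarrow> \<bar>qxx - C\<bar> \<le> L \<longrightarrow>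
        CLC_test \<alpha> a s r qee qxe qxx = 1"
      using eventually_CLC_test_eq_1_LMstar[OF weights level abar r0]
        eventually_CLC_test_eq_1_AR[OF weights level abar \<B>(1) params(2) \<B>(2) fixed_alternative r0]
      by (cases "LMstar_stat r0 (\<Delta>\<^sup>2) \<Delta> = 0") blast+
    then obtain \<eta> where \<eta>: "0 < \<eta>" and reject: "\<And>r C qee qxe qxx. dist r r0 < \<eta> \<Longrightarrow> c \<le> \<bar>C\<bar> \<Longrightarrow>
        \<bar>qee - \<Delta>\<^sup>2 * C\<bar> \<le> L \<Longrightarrow> \<bar>qxe - \<Delta> * C\<bar> \<le> L \<Longrightarrow> \<bar>qxx - C\<bar> \<le> L \<Longrightarrow>
        CLC_test \<alpha> a s r qee qxe qxx = 1"
      unfolding eventually_nhds_metric by blast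
    have "(\<lambda>n. outer_measure_of (M n) {\<omega> \<in> space (M n). \<eta> / 2 < dist (norm (\<gamma>h n \<beta>0 \<omega> - r0)) 0}) \<longlonglongrightarrow> 0"
      using assumption2 params(2) half_gt_zero[OF \<eta>]
      unfolding assumption2_def conv_in_prob_def r0_def by blast
    then have "\<forall>\<^sub>F n in sequentially.
        outer_measure_of (M n) {\<omega> \<in> space (M n). \<eta> / 2 < dist (norm (\<gamma>h n \<beta>0 \<omega> - r0)) 0} < ennreal (\<epsilon>' / 2)"
      using \<epsilon>' by (intro order_tendstoD(2)) auto
    moreover have "\<forall>\<^sub>F n in sequentially. c \<le> \<bar>conc Z \<Pi>X n\<bar>"
      using strong_id(3) by (simp add: filterlim_at_top)
    ultimately show "\<forall>\<^sub>F n in sequentially. outer_measure_of (M n) (N n) < \<epsilon>"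
      using L
    proof eventually_elim
      case (elim n)
      let ?A = "{\<omega> \<in> space (M n). \<eta> / 2 < dist (norm (\<gamma>h n \<beta>0 \<omega> - r0)) 0}"
      let ?B = "{\<omega> \<in> space (M n). L < norm (T n \<omega>)}"
      \<comment> \<open>Outside both events the estimate is within
        \<open>\<eta> / 2 < \<eta>\<close> of \<open>r0\<close> and every error is at most
        \<open>L\<close>, so the test rejects.\<close>
      have "N n \<subseteq> ?A \<union> ?B"
      proof (rule ccontr)
        assume "\<not> N n \<subseteq> ?A \<union> ?B"
        then obtain \<omega> where \<omega>: "\<omega> \<in> N n" "\<omega> \<notin> ?A" "\<omega> \<notin> ?B" by blast
        then have "\<omega> \<in> space (M n)" by (simp add: N_def)
        then have "dist (\<gamma>h n \<beta>0 \<omega>) r0 < \<eta>" and T: "norm (T n \<omega>) \<le> L"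
          using \<omega> \<eta> by (auto simp: dist_norm)
        moreover have "norm (fst (T n \<omega>)) \<le> L" "norm (fst (snd (T n \<omega>))) \<le> L" "norm (snd (snd (T n \<omega>))) \<le> L"
          using T norm_fst_le norm_snd_le by (metis order_trans prod.collapse)+
        ultimately have "CLC_test \<alpha> a s (\<gamma>h n \<beta>0 \<omega>) (Q_ee Z X Y \<beta>0 n \<omega>) (Q_Xe Z X Y \<beta>0 n \<omega>) (Q_XX Z X n \<omega>) = 1"
          using elim(2) by (intro reject) (auto simp: T_def)
        then show False using \<omega>(1) by (simp add: N_def)
      qed
      then have "outer_measure_of (M n) (N n) \<le> outer_measure_of (M n) (?A \<union> ?B)"
        by (rule outer_measure_of_mono)
      also have "\<dots> \<le> outer_measure_of (M n) ?A + outer_measure_of (M n) ?B"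
        by (rule outer_measure_of_Un_le) auto
      also have "\<dots> \<le> ennreal (\<epsilon>' / 2) + ennreal (\<epsilon>' / 2)"
        using elim(1,3) by (intro add_mono) auto
      finally show ?case using \<epsilon>'(2) by (rule le_less_trans)
    qed
  qed auto
  \<comment> \<open>For positive \<open>\<epsilon>\<close> the deviation event lies in
    \<open>N n\<close>.\<close>
  then have "(\<lambda>n. outer_measure_of (M n) {\<omega> \<in> space (M n). \<epsilon> < dist (CLC_test \<alpha> a s (\<gamma>h n \<beta>0 \<omega>)
      (Q_ee Z X Y \<beta>0 n \<omega>) (Q_Xe Z X Y \<beta>0 n \<omega>) (Q_XX Z X n \<omega>)) 1}) \<longlonglongrightarrow> 0" if "0 < \<epsilon>" for \<epsilon>
    using that by (rule_tac tendsto_sandwich[OF _ _ tendsto_const])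
      (auto intro!: outer_measure_of_mono always_eventually simp: N_def)
  then show ?thesis by (simp add: conv_in_prob_def)
qed

end
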